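(* For any $q>0$ and any Lipschitz function $\varphi:[0,1]\to\mathbb{R}$ whose Lipschitz constant satisfies $\operatorname{Lip}(\varphi)\le 0.0014$, the transfer operator $\mathrm{L}_{T_q,\varphi}$ has a spectral gap when acting on the Banach space $\operatorname{Lip}([0,1])$ of real-valued Lipschitz functions on $[0,1]$.
   Context: For $q\in(0,+\infty)$, the Pommeau-Manneville map $T_q:[0,1]\to[0,1]$ is defined by $T_q(x)=x(1+(2x)^q)$ if $x\in[0,\frac12)$ and $T_q(x)=2x-1$ if $x\in[\frac12,1]$. Its inverse branches are $b_1,b_2:[0,1]\to[0,1]$: $b_1(x)$ is the unique $y\in[0,\frac12]$ such that $y(1+(2y)^q)=x$, and $b_2(x)=\frac{x+1}{2}$. (Thus $T_q^{-1}(x)=\{b_1(x),b_2(x)\}$ for all $x\ne 1$.) The transfer operator of $T_q$ with potential $\varphi$ is $$\mathrm{L}_{T_q,\varphi}f(x)=\frac12\sum_{j=1}^2 e^{\varphi(b_j(x))}f(b_j(x)).$$ $\operatorname{Lip}([0,1])$ is endowed with the norm $\lVert f\rVert=\lVert f\rVert_\infty+\operatorname{Lip}(f)$, where $\operatorname{Lip}(f)=\sup_{x\ne y}\frac{|f(x)-f(y)|}{|x-y|}$. A bounded linear operator $\mathrm{L}$ on a Banach space $\mathcal{X}$ has a spectral gap if it has an eigenvalue $\lambda>0$ with an eigenvector $u_0$, and there are a closed subspace $G\subset\mathcal{X}$ with $\langle u_0\rangle\oplus G=\mathcal{X}$ and $\mathrm{L}(G)\subset G$, and numbers $C>0$, $\delta\in(0,1)$,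 such that $\lVert (\mathrm{L}|_G)^n\rVert\le C\lambda^n(1-\delta)^n$ for all $n\in\mathbb{N}$. *)

theory Defs
  imports "HOL-Analysis.Analysis"
begin

section \<open>The Banach space of real-valued Lipschitz functions on $[0,1]$\<close>

definition is_lip01 :: "(real \<Rightarrow> real) \<Rightarrow> bool" where
  "is_lip01 f \<longleftrightarrow> (\<exists>C. C-lipschitz_on {0..1} f)"

text \<open>
  A real function on \<open>[0,1]\<close> is represented by its extension by \<open>0\<close> to the whole real line, so that
  equality in the type is equality on \<open>[0,1]\<close>.
\<close>

typedef lip01 = "{f :: real \<Rightarrow> real. is_lip01 f \<and> (\<forall>x. x \<notin> {0..1} \<longrightarrow> f x = 0)}"
  morphisms lip_app Abs_lip01
  by (rule exI[of _ "\<lambda>_. 0"]) (auto simp: is_lip01_def intro!: exI[of _ 0] lipschitz_onI)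

definition lip_restrict :: "(real \<Rightarrow> real) \<Rightarrow> lip01" where
  "lip_restrict f = Abs_lip01 (\<lambda>x. if x \<in> {0..1} then f x else 0)"

definition sup01 :: "(real \<Rightarrow> real) \<Rightarrow> real" where
  "sup01 f = (SUP x\<in>{0..1}. \<bar>f x\<bar>)"

definition lip_const :: "(real \<Rightarrow> real) \<Rightarrow> real" where
  "lip_const f =
     (SUP (x, y)\<in>{(x, y). x \<in> {0..1} \<and> y \<in> {0..1} \<and> x \<noteq> y}. \<bar>f x - f y\<bar> / \<bar>x - y\<bar>)"

lemma lip_app_is_lip [simp]: "is_lip01 (lip_app f)"
  using lip_app[of f] by auto

lemma lip_app_outside: "x \<notin> {0..1} \<Longrightarrow> lip_app f x = 0"
  using lip_app[of f] by auto

lemma is_lip01I: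
  assumes "\<And>x y. x \<in> {0..1} \<Longrightarrow> y \<in> {0..1} \<Longrightarrow> \<bar>f x - f y\<bar> \<le> C * \<bar>x - y\<bar>"
  shows "is_lip01 f"
proof -
  have "\<bar>f 0 - f 1\<bar> \<le> C * \<bar>0 - 1\<bar>" by (rule assms) auto
  hence "0 \<le> C" by simp
  hence "C-lipschitz_on {0..1} f"
    using assms by (intro lipschitz_onI) (auto simp: dist_real_def)
  thus ?thesis by (auto simp: is_lip01_def)
qed

lemma is_lip01_cong:
  assumes "\<And>x. x \<in> {0..1} \<Longrightarrow> f x = g x"
  shows "is_lip01 f \<longleftrightarrow> is_lip01 g"
  unfolding is_lip01_def lipschitz_on_def using assms by auto

lemma lip_app_restrict:
  assumes "is_lip01 f"
  shows "lip_app (lip_restrict f) = (\<lambda>x. if x \<in> {0..1} then f x else 0)"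
proof -
  have "is_lip01 (\<lambda>x. if x \<in> {0..1} then f x else 0)"
    using assms by (subst is_lip01_cong[of _ f]) auto
  thus ?thesis
    unfolding lip_restrict_def by (subst Abs_lip01_inverse) auto
qed

lemma lip_app_restrict_in [simp]:
  "is_lip01 f \<Longrightarrow> x \<in> {0..1} \<Longrightarrow> lip_app (lip_restrict f) x = f x"
  by (simp add: lip_app_restrict)

lemma lip01_eqI:
  assumes "\<And>x. x \<in> {0..1} \<Longrightarrow> lip_app f x = lip_app g x"
  shows "f = g"
proof -
  have "lip_app f = lip_app g"
    by (rule ext) (metis assms lip_app_outside)
  thus ?thesis by (simp add: lip_app_inject)
qed

lemma is_lip01_bounded:
  assumes "is_lip01 f"
  shows "\<exists>B. \<forall>x\<in>{0..1}. \<bar>f x\<bar> \<le> B"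
proof -
  obtain C where C: "C-lipschitz_on {0..1} f" using assms by (auto simp: is_lip01_def)
  have "continuous_on {0..1} f" using C by (rule lipschitz_on_continuous_on)
  hence "bounded (f ` {0..1})" by (intro compact_imp_bounded compact_continuous_image) auto
  thus ?thesis by (auto simp: bounded_iff)
qed

lemma sup01_upper:
  assumes "is_lip01 f" "x \<in> {0..1}"
  shows "\<bar>f x\<bar> \<le> sup01 f"
  using is_lip01_bounded[OF assms(1)] assms(2) unfolding sup01_def
  by (intro cSUP_upper) (auto simp: bdd_above_def)

lemma sup01_least:
  assumes "\<And>x. x \<in> {0..1} \<Longrightarrow> \<bar>f x\<bar> \<le> B"
  shows "sup01 f \<le> B"
  unfolding sup01_def using assms by (intro cSUP_least) auto

lemma lip_const_upper:
  assumes "is_lip01 f" "x \<in> {0..1}" "y \<in> {0..1}"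
  shows "\<bar>f x - f y\<bar> \<le> lip_const f * \<bar>x - y\<bar>"
proof (cases "x = y")
  case False
  obtain C where C: "C-lipschitz_on {0..1} f" using assms by (auto simp: is_lip01_def)
  have "bdd_above ((\<lambda>(x, y). \<bar>f x - f y\<bar> / \<bar>x - y\<bar>) `
      {(x, y). x \<in> {0..1} \<and> y \<in> {0..1} \<and> x \<noteq> y})"
    unfolding bdd_above_def using lipschitz_onD[OF C]
    by (intro exI[of _ C]) (auto simp: dist_real_def divide_le_eq)
  hence "(\<lambda>(x, y). \<bar>f x - f y\<bar> / \<bar>x - y\<bar>) (x, y) \<le> lip_const f"
    unfolding lip_const_def using assms False by (intro cSUP_upper) auto
  thus ?thesis using False by (simp add: divide_le_eq)
qed simp

lemma lip_const_least:
  assumes "\<And>x y. x \<in> {0..1} \<Longrightarrow> y \<in> {0..1} \<Longrightarrow> \<bar>f x - f y\<bar> \<le> C * \<bar>x - y\<bar>"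
  shows "lip_const f \<le> C"
proof -
  have ne: "(0, 1) \<in> {(x, y). x \<in> {0..1::real} \<and> y \<in> {0..1::real} \<and> x \<noteq> y}" by auto
  show ?thesis
    unfolding lip_const_def
  proof (rule cSUP_least)
    show "{(x, y). x \<in> {0..1::real} \<and> y \<in> {0..1::real} \<and> x \<noteq> y} \<noteq> {}" using ne by blast
  qed (use assms in \<open>auto simp: divide_le_eq\<close>)
qed

lemma sup01_nonneg: "is_lip01 f \<Longrightarrow> 0 \<le> sup01 f"
  using sup01_upper[of f 0] by simp

lemma lip_const_nonneg: "is_lip01 f \<Longrightarrow> 0 \<le> lip_const f"
  using lip_const_upper[of f 0 1] by simp

lemma is_lip01_add: "is_lip01 f \<Longrightarrow> is_lip01 g \<Longrightarrow> is_lip01 (\<lambda>x. f x + g x)"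
  unfolding is_lip01_def by (blast intro: lipschitz_on_add)

lemma is_lip01_cmult: "is_lip01 f \<Longrightarrow> is_lip01 (\<lambda>x. c * f x)"
  unfolding is_lip01_def using lipschitz_on_cmult_real by blast

lemma is_lip01_mult:
  assumes "is_lip01 f" "is_lip01 g"
  shows "is_lip01 (\<lambda>x. f x * g x)"
proof (rule is_lip01I)
  fix x y :: real assume xy: "x \<in> {0..1}" "y \<in> {0..1}"
  have "\<bar>f x * g x - f y * g y\<bar> = \<bar>f x * (g x - g y) + (f x - f y) * g y\<bar>"
    by (simp add: algebra_simps)
  also have "\<dots> \<le> \<bar>f x\<bar> * \<bar>g x - g y\<bar> + \<bar>f x - f y\<bar> * \<bar>g y\<bar>"
    by (metis abs_mult abs_triangle_ineq)
  also have "\<dots> \<le> sup01 f * (lip_const g * \<bar>x - y\<bar>) + (lip_const f * \<bar>x - y\<bar>) * sup01 g"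
    using assms xy
    by (intro add_mono mult_mono sup01_upper lip_const_upper)
       (auto intro!: mult_nonneg_nonneg sup01_nonneg lip_const_nonneg)
  finally show "\<bar>f x * g x - f y * g y\<bar> \<le> (sup01 f * lip_const g + lip_const f * sup01 g) * \<bar>x - y\<bar>"
    by (simp add: algebra_simps)
qed

lemma is_lip01_exp:
  assumes "is_lip01 f"
  shows "is_lip01 (\<lambda>x. exp (f x))"
proof -
  have le: "exp a - exp b \<le> exp M * \<bar>a - b\<bar>" if "a \<le> M" for a b M :: real
  proof -
    have "exp a * (1 + (b - a)) \<le> exp a * exp (b - a)"
      by (intro mult_left_mono exp_ge_add_one_self) auto
    hence "exp a - exp b \<le> exp a * (a - b)" by (simp add: algebra_simps flip: exp_add)
    also have "\<dots> \<le> exp a * \<bar>a - b\<bar>" by (intro mult_left_mono) auto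
    also have "\<dots> \<le> exp M * \<bar>a - b\<bar>" using that by (intro mult_right_mono) auto
    finally show ?thesis .
  qed
  show ?thesis
  proof (rule is_lip01I)
    fix x y :: real assume xy: "x \<in> {0..1}" "y \<in> {0..1}"
    have "f x \<le> sup01 f" "f y \<le> sup01 f"
      using sup01_upper[OF assms, of x] sup01_upper[OF assms, of y] xy by linarith+
    hence "\<bar>exp (f x) - exp (f y)\<bar> \<le> exp (sup01 f) * \<bar>f x - f y\<bar>"
      using le[of "f x" "sup01 f" "f y"] le[of "f y" "sup01 f" "f x"]
      by (simp add: abs_le_iff abs_minus_commute)
    also have "\<dots> \<le> exp (sup01 f) * (lip_const f * \<bar>x - y\<bar>)"
      using assms xy by (intro mult_left_mono lip_const_upper) auto
    finally show "\<bar>exp (f x) - exp (f y)\<bar> \<le> (exp (sup01 f) * lip_const f) * \<bar>x - y\<bar>"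
      by (simp add: mult.assoc)
  qed
qed

lemma is_lip01_compose:
  assumes f: "is_lip01 f" and g: "is_lip01 g" and r: "\<And>x. x \<in> {0..1} \<Longrightarrow> g x \<in> {0..1}"
  shows "is_lip01 (\<lambda>x. f (g x))"
proof (rule is_lip01I)
  fix x y :: real assume xy: "x \<in> {0..1}" "y \<in> {0..1}"
  have "\<bar>f (g x) - f (g y)\<bar> \<le> lip_const f * \<bar>g x - g y\<bar>"
    using f xy r by (intro lip_const_upper) blast+
  also have "\<dots> \<le> lip_const f * (lip_const g * \<bar>x - y\<bar>)"
    using f g xy by (intro mult_left_mono lip_const_upper lip_const_nonneg)
  finally show "\<bar>f (g x) - f (g y)\<bar> \<le> (lip_const f * lip_const g) * \<bar>x - y\<bar>"
    by (simp add: mult.assoc)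
qed

instantiation lip01 :: real_normed_vector
begin

definition zero_lip01 :: lip01 where
  "0 = lip_restrict (\<lambda>_. 0)"

definition plus_lip01 :: "lip01 \<Rightarrow> lip01 \<Rightarrow> lip01" where
  "f + g = lip_restrict (\<lambda>x. lip_app f x + lip_app g x)"

definition minus_lip01 :: "lip01 \<Rightarrow> lip01 \<Rightarrow> lip01" where
  "f - g = lip_restrict (\<lambda>x. lip_app f x - lip_app g x)"

definition uminus_lip01 :: "lip01 \<Rightarrow> lip01" where
  "- f = lip_restrict (\<lambda>x. - lip_app f x)"

definition scaleR_lip01 :: "real \<Rightarrow> lip01 \<Rightarrow> lip01" where
  "c *\<^sub>R f = lip_restrict (\<lambda>x. c * lip_app f x)"

definition norm_lip01 :: "lip01 \<Rightarrow> real" where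
  "norm f = sup01 (lip_app f) + lip_const (lip_app f)"

definition dist_lip01 :: "lip01 \<Rightarrow> lip01 \<Rightarrow> real" where
  "dist f g = norm (f - g :: lip01)"

definition sgn_lip01 :: "lip01 \<Rightarrow> lip01" where
  "sgn f = inverse (norm f) *\<^sub>R (f :: lip01)"

definition uniformity_lip01 :: "(lip01 \<times> lip01) filter" where
  "(uniformity :: (lip01 \<times> lip01) filter) = (INF e\<in>{0<..}. principal {(x, y). dist x y < e})"

definition open_lip01 :: "lip01 set \<Rightarrow> bool" where
  "open (S :: lip01 set) = (\<forall>x\<in>S. \<forall>\<^sub>F (x', y) in uniformity. x' = x \<longrightarrow> y \<in> S)"

lemma lip_app_zero: "lip_app 0 x = 0"
proof -
  have "is_lip01 (\<lambda>_. 0)" by (rule is_lip01I[of _ 0]) auto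
  thus ?thesis unfolding zero_lip01_def by (simp add: lip_app_restrict)
qed

lemma lip_app_add: "lip_app (f + g) x = lip_app f x + lip_app g x"
  unfolding plus_lip01_def by (simp add: lip_app_restrict is_lip01_add lip_app_outside)

lemma lip_app_scaleR: "lip_app (c *\<^sub>R f) x = c * lip_app f x"
  unfolding scaleR_lip01_def by (simp add: lip_app_restrict is_lip01_cmult lip_app_outside)

lemma lip_app_uminus: "lip_app (- f) x = - lip_app f x"
proof -
  have "is_lip01 (\<lambda>x. - lip_app f x)" using is_lip01_cmult[of "lip_app f" "-1"] by simp
  thus ?thesis unfolding uminus_lip01_def by (simp add: lip_app_restrict lip_app_outside)
qed

lemma lip_app_diff: "lip_app (f - g) x = lip_app f x - lip_app g x"
proof -
  have "is_lip01 (\<lambda>x. lip_app f x - lip_app g x)"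
    using is_lip01_add[of "lip_app f" "\<lambda>x. - lip_app g x"] is_lip01_cmult[of "lip_app g" "-1"] by simp
  thus ?thesis unfolding minus_lip01_def by (simp add: lip_app_restrict lip_app_outside)
qed

lemmas lip_app_simps = lip_app_zero lip_app_add lip_app_scaleR lip_app_uminus lip_app_diff

lemma lip01_norm_le:
  assumes "\<And>x. x \<in> {0..1} \<Longrightarrow> \<bar>lip_app f x\<bar> \<le> a"
    and "\<And>x y. x \<in> {0..1} \<Longrightarrow> y \<in> {0..1} \<Longrightarrow> \<bar>lip_app f x - lip_app f y\<bar> \<le> b * \<bar>x - y\<bar>"
  shows "norm f \<le> a + b"
  unfolding norm_lip01_def
  by (intro add_mono sup01_least lip_const_least) (use assms in blast)+

lemma lip01_sup_le_norm: "x \<in> {0..1} \<Longrightarrow> \<bar>lip_app f x\<bar> \<le> norm f"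
  using sup01_upper[of "lip_app f" x] lip_const_nonneg[of "lip_app f"]
  unfolding norm_lip01_def by simp

lemma lip01_norm_scaleR_le: "norm (c *\<^sub>R f) \<le> \<bar>c\<bar> * norm (f :: lip01)"
proof -
  have "norm (c *\<^sub>R f) \<le> \<bar>c\<bar> * sup01 (lip_app f) + \<bar>c\<bar> * lip_const (lip_app f)"
  proof (rule lip01_norm_le)
    fix x :: real assume "x \<in> {0..1}"
    thus "\<bar>lip_app (c *\<^sub>R f) x\<bar> \<le> \<bar>c\<bar> * sup01 (lip_app f)"
      by (auto simp: lip_app_simps abs_mult intro!: mult_left_mono sup01_upper)
  next
    fix x y :: real assume xy: "x \<in> {0..1}" "y \<in> {0..1}"
    have "\<bar>lip_app (c *\<^sub>R f) x - lip_app (c *\<^sub>R f) y\<bar> = \<bar>c\<bar> * \<bar>lip_app f x - lip_app f y\<bar>"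
      by (simp add: lip_app_simps abs_mult flip: right_diff_distrib)
    also have "\<dots> \<le> \<bar>c\<bar> * (lip_const (lip_app f) * \<bar>x - y\<bar>)"
      using xy by (intro mult_left_mono lip_const_upper) auto
    finally show "\<bar>lip_app (c *\<^sub>R f) x - lip_app (c *\<^sub>R f) y\<bar> \<le> (\<bar>c\<bar> * lip_const (lip_app f)) * \<bar>x - y\<bar>"
      by (simp add: mult.assoc)
  qed
  thus ?thesis by (simp add: norm_lip01_def distrib_left)
qed

instance
proof
  fix f g :: lip01 and a b :: real
  show "norm f = 0 \<longleftrightarrow> f = 0"
  proof
    assume n: "norm f = 0"
    show "f = 0"
    proof (rule lip01_eqI)
      fix x :: real assume "x \<in> {0..1}"
      thus "lip_app f x = lip_app 0 x"
        using lip01_sup_le_norm[of x f] n by (simp add: lip_app_zero)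
    qed
  next
    assume f: "f = 0"
    have "norm f \<le> 0 + 0" by (rule lip01_norm_le) (auto simp: f lip_app_zero)
    moreover have "0 \<le> norm f" using lip01_sup_le_norm[of 0 f] by simp
    ultimately show "norm f = 0" by simp
  qed
  show "norm (f + g) \<le> norm f + norm g"
  proof -
    have "norm (f + g) \<le> (sup01 (lip_app f) + sup01 (lip_app g))
        + (lip_const (lip_app f) + lip_const (lip_app g))"
    proof (rule lip01_norm_le)
      fix x :: real assume "x \<in> {0..1}"
      thus "\<bar>lip_app (f + g) x\<bar> \<le> sup01 (lip_app f) + sup01 (lip_app g)"
        using sup01_upper[of "lip_app f" x] sup01_upper[of "lip_app g" x]
        by (simp add: lip_app_simps)
    next
      fix x y :: real assume "x \<in> {0..1}" "y \<in> {0..1}"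
      hence "\<bar>lip_app f x - lip_app f y\<bar> \<le> lip_const (lip_app f) * \<bar>x - y\<bar>"
        "\<bar>lip_app g x - lip_app g y\<bar> \<le> lip_const (lip_app g) * \<bar>x - y\<bar>"
        by (auto intro!: lip_const_upper)
      thus "\<bar>lip_app (f + g) x - lip_app (f + g) y\<bar>
          \<le> (lip_const (lip_app f) + lip_const (lip_app g)) * \<bar>x - y\<bar>"
        by (simp add: lip_app_simps distrib_right)
    qed
    thus ?thesis by (simp add: norm_lip01_def)
  qed
  show "norm (a *\<^sub>R f) = \<bar>a\<bar> * norm f"
  proof (cases "a = 0")
    case True
    have "0 \<le> norm (a *\<^sub>R f)" using lip01_sup_le_norm[of 0 "a *\<^sub>R f"] by simp
    with lip01_norm_scaleR_le[of a f] True show ?thesis by simp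
  next
    case False
    have "inverse a *\<^sub>R (a *\<^sub>R f) = f"
      by (rule lip01_eqI) (use False in \<open>simp add: lip_app_simps\<close>)
    hence "norm f \<le> \<bar>inverse a\<bar> * norm (a *\<^sub>R f)"
      using lip01_norm_scaleR_le[of "inverse a" "a *\<^sub>R f"] by simp
    hence "\<bar>a\<bar> * norm f \<le> norm (a *\<^sub>R f)"
      using False by (simp add: field_simps)
    with lip01_norm_scaleR_le[of a f] show ?thesis by simp
  qed
qed (auto simp: dist_lip01_def sgn_lip01_def uniformity_lip01_def open_lip01_def
      lip_app_simps algebra_simps intro!: lip01_eqI)

end

instance lip01 :: banach
proof
  fix X :: "nat \<Rightarrow> lip01"
  assume "Cauchy X"
  hence Cau: "\<exists>M. \<forall>m\<ge>M. \<forall>n\<ge>M. norm (X m - X n) < e" if "e > 0" for e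
    using that unfolding Cauchy_def dist_norm by blast
  define g where "g x = lim (\<lambda>n. lip_app (X n) x)" for x
  have conv: "(\<lambda>n. lip_app (X n) x) \<longlonglongrightarrow> g x" if x: "x \<in> {0..1}" for x
  proof -
    have "Cauchy (\<lambda>n. lip_app (X n) x)"
      unfolding Cauchy_def
    proof (intro allI impI)
      fix e :: real assume "e > 0"
      then obtain M where M: "\<forall>m\<ge>M. \<forall>n\<ge>M. norm (X m - X n) < e" using Cau by blast
      show "\<exists>M. \<forall>m\<ge>M. \<forall>n\<ge>M. dist (lip_app (X m) x) (lip_app (X n) x) < e"
      proof (intro exI[of _ M] allI impI)
        fix m n assume "m \<ge> M" "n \<ge> M"
        thus "dist (lip_app (X m) x) (lip_app (X n) x) < e"
          using M lip01_sup_le_norm[OF x, of "X m - X n"]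
          by (auto simp: lip_app_simps dist_real_def intro: le_less_trans)
      qed
    qed
    thus ?thesis unfolding g_def by (simp add: Cauchy_convergent_iff convergent_LIMSEQ_iff)
  qed
  have close_sup: "\<bar>lip_app (X m) x - g x\<bar> \<le> e"
    and close_lip: "y \<in> {0..1} \<Longrightarrow>
      \<bar>(lip_app (X m) x - g x) - (lip_app (X m) y - g y)\<bar> \<le> e * \<bar>x - y\<bar>"
    if M: "\<forall>m\<ge>M. \<forall>n\<ge>M. norm (X m - X n) < e" and m: "m \<ge> M" and x: "x \<in> {0..1}"
    for M e m x y
  proof -
    show "\<bar>lip_app (X m) x - g x\<bar> \<le> e"
    proof (rule tendsto_upperbound)
      show "(\<lambda>n. \<bar>lip_app (X m) x - lip_app (X n) x\<bar>) \<longlonglongrightarrow> \<bar>lip_app (X m) x - g x\<bar>"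
        by (intro tendsto_intros conv x)
      show "\<forall>\<^sub>F n in sequentially. \<bar>lip_app (X m) x - lip_app (X n) x\<bar> \<le> e"
        unfolding eventually_sequentially
      proof (intro exI[of _ M] allI impI)
        fix n assume "n \<ge> M"
        thus "\<bar>lip_app (X m) x - lip_app (X n) x\<bar> \<le> e"
          using M m lip01_sup_le_norm[OF x, of "X m - X n"]
          by (force simp: lip_app_simps)
      qed
    qed simp
    assume y: "y \<in> {0..1}"
    show "\<bar>(lip_app (X m) x - g x) - (lip_app (X m) y - g y)\<bar> \<le> e * \<bar>x - y\<bar>"
    proof (rule tendsto_upperbound)
      show "(\<lambda>n. \<bar>(lip_app (X m) x - lip_app (X n) x) - (lip_app (X m) y - lip_app (X n) y)\<bar>)
          \<longlonglongrightarrow> \<bar>(lip_app (X m) x - g x) - (lip_app (X m) y - g y)\<bar>"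
        by (intro tendsto_intros conv x y)
      show "\<forall>\<^sub>F n in sequentially.
          \<bar>(lip_app (X m) x - lip_app (X n) x) - (lip_app (X m) y - lip_app (X n) y)\<bar> \<le> e * \<bar>x - y\<bar>"
        unfolding eventually_sequentially
      proof (intro exI[of _ M] allI impI)
        fix n assume "n \<ge> M"
        hence "norm (X m - X n) < e" using M m by blast
        hence "lip_const (lip_app (X m - X n)) \<le> e"
          using sup01_nonneg[of "lip_app (X m - X n)"] by (simp add: norm_lip01_def)
        hence "lip_const (lip_app (X m - X n)) * \<bar>x - y\<bar> \<le> e * \<bar>x - y\<bar>"
          by (intro mult_right_mono) auto
        thus "\<bar>(lip_app (X m) x - lip_app (X n) x) - (lip_app (X m) y - lip_app (X n) y)\<bar> \<le> e * \<bar>x - y\<bar>"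
          using lip_const_upper[of "lip_app (X m - X n)" x y] x y by (simp add: lip_app_simps)
      qed
    qed simp
  qed
  have g: "is_lip01 g"
  proof -
    obtain M where M: "\<forall>m\<ge>M. \<forall>n\<ge>M. norm (X m - X n) < 1" using Cau[of 1] by auto
    show ?thesis
    proof (rule is_lip01I)
      fix x y :: real assume xy: "x \<in> {0..1}" "y \<in> {0..1}"
      have "\<bar>lip_app (X M) x - lip_app (X M) y\<bar> \<le> lip_const (lip_app (X M)) * \<bar>x - y\<bar>"
        using xy by (intro lip_const_upper) auto
      with close_lip[OF M order.refl xy]
      show "\<bar>g x - g y\<bar> \<le> (lip_const (lip_app (X M)) + 1) * \<bar>x - y\<bar>"
        by (simp add: distrib_right)
    qed
  qed
  have "X \<longlonglongrightarrow> lip_restrict g"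
  proof (rule metric_LIMSEQ_I)
    fix e :: real assume "e > 0"
    then obtain M where M: "\<forall>m\<ge>M. \<forall>n\<ge>M. norm (X m - X n) < e / 4" using Cau[of "e / 4"] by auto
    show "\<exists>no. \<forall>n\<ge>no. dist (X n) (lip_restrict g) < e"
    proof (intro exI[of _ M] allI impI)
      fix n assume n: "n \<ge> M"
      have "norm (X n - lip_restrict g) \<le> e / 4 + e / 4"
        by (rule lip01_norm_le)
           (use close_sup[OF M n] close_lip[OF M n] g in \<open>auto simp: lip_app_simps\<close>)
      thus "dist (X n) (lip_restrict g) < e" using \<open>e > 0\<close> by (simp add: dist_norm)
    qed
  qed
  thus "convergent X" by (auto simp: convergent_def)
qed


section \<open>Spectral gap\<close>

text \<open>
  The operator norm of the restriction of \<open>f\<close> to a subspace \<open>G\<close>; compare \<open>onorm_def\<close>. As there, the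
  convention \<open>x / 0 = 0\<close> makes the zero vector harmless.
\<close>

definition onorm_on :: "'a::real_normed_vector set \<Rightarrow> ('a \<Rightarrow> 'b::real_normed_vector) \<Rightarrow> real" where
  "onorm_on G f = (SUP x\<in>G. norm (f x) / norm x)"

lemma onorm_on_UNIV: "onorm_on UNIV f = onorm f"
  by (simp add: onorm_on_def onorm_def)

lemma onorm_on_le_iff:
  assumes "bounded_linear f" "subspace G" "0 \<le> b"
  shows "onorm_on G f \<le> b \<longleftrightarrow> (\<forall>x\<in>G. norm (f x) \<le> b * norm x)"
proof -
  interpret f: bounded_linear f by fact
  have "bdd_above ((\<lambda>x. norm (f x) / norm x) ` G)"
    by (rule bdd_aboveI2[where M = "onorm f"]) (rule le_onorm[OF assms(1)])
  moreover have "G \<noteq> {}" using subspace_0[OF assms(2)] by auto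
  ultimately have "onorm_on G f \<le> b \<longleftrightarrow> (\<forall>x\<in>G. norm (f x) / norm x \<le> b)"
    unfolding onorm_on_def by (rule cSUP_le_iff[rotated])
  also have "\<dots> \<longleftrightarrow> (\<forall>x\<in>G. norm (f x) \<le> b * norm x)"
  proof (intro ball_cong refl)
    fix x show "norm (f x) / norm x \<le> b \<longleftrightarrow> norm (f x) \<le> b * norm x"
      using assms(3) by (cases "x = 0") (auto simp: divide_le_eq f.zero)
  qed
  finally show ?thesis .
qed

definition has_spectral_gap :: "('a::banach \<Rightarrow> 'a) \<Rightarrow> bool" where
  "has_spectral_gap L \<longleftrightarrow>
     bounded_linear L \<and>
     (\<exists>lam u0 G C \<delta>.
        lam > 0 \<and> u0 \<noteq> 0 \<and> L u0 = lam *\<^sub>R u0 \<and>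
        subspace G \<and> closed G \<and>
        span {u0} \<inter> G = {0} \<and> {v + g | v g. v \<in> span {u0} \<and> g \<in> G} = UNIV \<and>
        L ` G \<subseteq> G \<and>
        C > 0 \<and> 0 < \<delta> \<and> \<delta> < 1 \<and>
        (\<forall>n. onorm_on G (L ^^ n) \<le> C * lam ^ n * (1 - \<delta>) ^ n))"


section \<open>The Pommeau-Manneville map and its transfer operator\<close>

definition pm_map :: "real \<Rightarrow> real \<Rightarrow> real" where
  "pm_map q x = (if x < 1/2 then x * (1 + (2 * x) powr q) else 2 * x - 1)"

definition pm_b1 :: "real \<Rightarrow> real \<Rightarrow> real" where
  "pm_b1 q x = (THE y. y \<in> {0..1/2} \<and> y * (1 + (2 * y) powr q) = x)"

definition pm_b2 :: "real \<Rightarrow> real" where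
  "pm_b2 x = (x + 1) / 2"

definition pm_transfer_fun :: "real \<Rightarrow> (real \<Rightarrow> real) \<Rightarrow> (real \<Rightarrow> real) \<Rightarrow> real \<Rightarrow> real" where
  "pm_transfer_fun q \<phi> f x =
     1/2 * (exp (\<phi> (pm_b1 q x)) * f (pm_b1 q x) + exp (\<phi> (pm_b2 x)) * f (pm_b2 x))"

text \<open>
  For \<open>q > 0\<close> the function under \<open>lip_restrict\<close> is Lipschitz (\<open>is_lip01_pm_transfer_fun\<close> below), so the
  operator is given by the formula pointwise on \<open>[0,1]\<close> (\<open>lip_app_pm_transfer\<close>).
\<close>

definition pm_transfer :: "real \<Rightarrow> lip01 \<Rightarrow> lip01 \<Rightarrow> lip01" where
  "pm_transfer q \<phi> f = lip_restrict (pm_transfer_fun q (lip_app \<phi>) (lip_app f))"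

lemma pm_left_expand:
  fixes q y z :: real
  assumes "q > 0" "0 \<le> y" "y \<le> z"
  shows "z - y \<le> z * (1 + (2 * z) powr q) - y * (1 + (2 * y) powr q)"
proof -
  have "y * (2 * y) powr q \<le> z * (2 * z) powr q"
    using assms by (intro mult_mono powr_mono2) auto
  thus ?thesis by (simp add: algebra_simps)
qed

lemma pm_b1_ex1:
  fixes q x :: real
  assumes q: "q > 0" and x: "x \<in> {0..1}"
  shows "\<exists>!y. y \<in> {0..1/2} \<and> y * (1 + (2 * y) powr q) = x"
proof -
  have "\<exists>y\<ge>0. y \<le> 1/2 \<and> y * (1 + (2 * y) powr q) = x"
  proof (rule IVT')
    show "continuous_on {0..1/2} (\<lambda>y. y * (1 + (2 * y) powr q))"
      using q by (intro continuous_on_mult continuous_on_add continuous_on_powr' continuous_on_id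
          continuous_on_const) auto
  qed (use x in auto)
  moreover have "y = z"
    if "y \<in> {0..1/2} \<and> y * (1 + (2 * y) powr q) = x"
       "z \<in> {0..1/2} \<and> z * (1 + (2 * z) powr q) = x" for y z
    using pm_left_expand[OF q, of y z] pm_left_expand[OF q, of z y] that
    by (cases "y \<le> z") auto
  ultimately show ?thesis by (metis (no_types, lifting) atLeastAtMost_iff)
qed

lemma pm_b1:
  assumes "q > 0" "x \<in> {0..1}"
  shows "pm_b1 q x \<in> {0..1/2}" "pm_b1 q x * (1 + (2 * pm_b1 q x) powr q) = x"
  using theI'[OF pm_b1_ex1[OF assms]] unfolding pm_b1_def by auto

lemma pm_b1_unique:
  assumes "q > 0" "y \<in> {0..1/2}" "y * (1 + (2 * y) powr q) = x" "x \<in> {0..1}"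
  shows "pm_b1 q x = y"
  using pm_b1_ex1[OF assms(1,4)] pm_b1[OF assms(1,4)] assms(2,3) by blast

lemma pm_map_preimage:
  assumes q: "q > 0" and x: "x \<in> {0..1}" "x \<noteq> 1"
  shows "{y \<in> {0..1}. pm_map q y = x} = {pm_b1 q x, pm_b2 x}"
proof -
  have "pm_b1 q x \<noteq> 1/2"
  proof
    assume "pm_b1 q x = 1/2"
    with pm_b1(2)[OF q x(1)] x(2) show False by simp
  qed
  hence lt: "pm_b1 q x < 1/2" "0 \<le> pm_b1 q x" using pm_b1(1)[OF q x(1)] by auto
  have "y = pm_b1 q x \<or> y = pm_b2 x" if "y \<in> {0..1}" "pm_map q y = x" for y
    using that pm_b1_unique[OF q, of y x] x(1)
    by (auto simp: pm_map_def pm_b2_def split: if_splits)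
  moreover have "pm_map q (pm_b1 q x) = x" using lt pm_b1(2)[OF q x(1)] by (simp add: pm_map_def)
  moreover have "pm_map q (pm_b2 x) = x" using x by (auto simp: pm_map_def pm_b2_def field_simps)
  moreover have "pm_b1 q x \<in> {0..1}" "pm_b2 x \<in> {0..1}" using lt x by (auto simp: pm_b2_def)
  ultimately show ?thesis
    by (intro set_eqI) (metis (mono_tags, lifting) insert_iff mem_Collect_eq singletonD)
qed

lemma is_lip01_pm_b1:
  assumes "q > 0"
  shows "is_lip01 (pm_b1 q)"
proof (rule is_lip01I)
  fix x y :: real assume xy: "x \<in> {0..1}" "y \<in> {0..1}"
  show "\<bar>pm_b1 q x - pm_b1 q y\<bar> \<le> 1 * \<bar>x - y\<bar>"
    using pm_left_expand[OF assms, of "pm_b1 q x" "pm_b1 q y"]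
      pm_left_expand[OF assms, of "pm_b1 q y" "pm_b1 q x"]
      pm_b1[OF assms xy(1)] pm_b1[OF assms xy(2)]
    by (cases "pm_b1 q x \<le> pm_b1 q y") auto
qed

lemma is_lip01_pm_transfer_fun:
  assumes q: "q > 0" and "is_lip01 \<phi>" "is_lip01 f"
  shows "is_lip01 (pm_transfer_fun q \<phi> f)"
proof -
  have b1: "pm_b1 q x \<in> {0..1}" if "x \<in> {0..1}" for x
    using pm_b1(1)[OF q that] by auto
  have b2: "pm_b2 x \<in> {0..1}" if "x \<in> {0..1}" for x
    using that by (auto simp: pm_b2_def)
  have lip2: "is_lip01 pm_b2"
    by (rule is_lip01I[of _ 1]) (auto simp: pm_b2_def abs_if field_simps)
  have c: "is_lip01 (\<lambda>x. h (pm_b1 q x))" "is_lip01 (\<lambda>x. h (pm_b2 x))" if "is_lip01 h" for h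
    using is_lip01_compose[OF that is_lip01_pm_b1[OF q] b1] is_lip01_compose[OF that lip2 b2]
    by blast+
  show ?thesis
    unfolding pm_transfer_fun_def
    by (rule is_lip01_cmult, rule is_lip01_add; rule is_lip01_mult)
       (rule c is_lip01_exp assms)+
qed

lemma lip_app_pm_transfer:
  assumes "q > 0" "x \<in> {0..1}"
  shows "lip_app (pm_transfer q \<phi> f) x =
    1/2 * (exp (lip_app \<phi> (pm_b1 q x)) * lip_app f (pm_b1 q x)
         + exp (lip_app \<phi> (pm_b2 x)) * lip_app f (pm_b2 x))"
  using assms by (simp add: pm_transfer_def is_lip01_pm_transfer_fun pm_transfer_fun_def)

end

theory Submission
  imports Defs
begin

text \<open>
  A positive function with \<open>\<bar>f x - f y\<bar> \<le> c \<bar>x - y\<bar> f y\<close> has relative Lipschitz constant \<open>c\<close>.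
  Since the left branch is nonexpanding, the right branch contracts by \<open>1/2\<close>, and the two
  carry comparable weights, the transfer operator \<open>L\<close> maps functions of relative constant \<open>1/100\<close>
  to such functions, and averaging along the two branches with weights \<open>exp \<phi> \<cdot> g\<close>, \<open>g\<close> of relative
  constant \<open>1/100\<close>, contracts the Lipschitz seminorm by \<open>4/5\<close>. If \<open>g n\<close> is the
  normalisation of \<open>L\<^sup>n 1\<close> at \<open>0\<close>, then the ratios \<open>L (g n) / g n\<close> are successive averages of
  this kind, hence become constant exponentially fast, and \<open>g n\<close> converges to an eigenfunction \<open>h\<close>.
  Conjugating \<open>L\<close> by \<open>h\<close> gives \<open>\<lambda>\<close> times an averaging operator \<open>A\<close>; its iterates converge
  exponentially to constants, and \<open>f \<mapsto> lim A\<^sup>n (f / h)\<close> is the functional whose kernel is the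
  complement \<open>G\<close>.
\<close>

section \<open>Relatively Lipschitz functions\<close>

text \<open>Division-free form of a Lipschitz bound for the logarithm: it ignores positive scalar
  factors, and its inequality survives pointwise limits.\<close>

definition rel_lip :: "real \<Rightarrow> (real \<Rightarrow> real) \<Rightarrow> bool" where
  "rel_lip c f \<longleftrightarrow> (\<forall>x\<in>{0..1}. 0 < f x) \<and>
     (\<forall>x\<in>{0..1}. \<forall>y\<in>{0..1}. \<bar>f x - f y\<bar> \<le> c * \<bar>x - y\<bar> * f y)"

lemma rel_lipI:
  assumes "\<And>x. x \<in> {0..1} \<Longrightarrow> 0 < f x"
    and "\<And>x y. x \<in> {0..1} \<Longrightarrow> y \<in> {0..1} \<Longrightarrow> \<bar>f x - f y\<bar> \<le> c * \<bar>x - y\<bar> * f y"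
  shows "rel_lip c f"
  using assms unfolding rel_lip_def by blast

lemma rel_lip_pos: "rel_lip c f \<Longrightarrow> x \<in> {0..1} \<Longrightarrow> 0 < f x"
  unfolding rel_lip_def by blast

lemma rel_lipD:
  "rel_lip c f \<Longrightarrow> x \<in> {0..1} \<Longrightarrow> y \<in> {0..1} \<Longrightarrow> \<bar>f x - f y\<bar> \<le> c * \<bar>x - y\<bar> * f y"
  unfolding rel_lip_def by blast

lemma rel_lip_nonneg:
  assumes "rel_lip c f"
  shows "0 \<le> c"
proof -
  have "0 \<le> c * f 0" using rel_lipD[OF assms, of 1 0] by simp
  thus ?thesis using rel_lip_pos[OF assms, of 0] by (simp add: zero_le_mult_iff)
qed

lemma rel_lip_le:
  assumes f: "rel_lip c f" and xy: "x \<in> {0..1}" "y \<in> {0..1}"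
  shows "f x \<le> (1 + c) * f y"
proof -
  have "\<bar>x - y\<bar> \<le> 1" using xy by auto
  hence "c * \<bar>x - y\<bar> * f y \<le> c * 1 * f y"
    using rel_lip_nonneg[OF f] rel_lip_pos[OF f xy(2)] by (intro mult_right_mono mult_left_mono) auto
  thus ?thesis using rel_lipD[OF f xy] by (simp add: algebra_simps)
qed

lemma rel_lip_mono:
  assumes f: "rel_lip c f" and "c \<le> d"
  shows "rel_lip d f"
proof (rule rel_lipI)
  fix x y :: real assume xy: "x \<in> {0..1}" "y \<in> {0..1}"
  have "c * \<bar>x - y\<bar> * f y \<le> d * \<bar>x - y\<bar> * f y"
    using assms(2) rel_lip_pos[OF f xy(2)] by (intro mult_right_mono) auto
  thus "\<bar>f x - f y\<bar> \<le> d * \<bar>x - y\<bar> * f y" using rel_lipD[OF f xy] by simp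
qed (rule rel_lip_pos[OF f])

lemma rel_lip_divide_const:
  assumes f: "rel_lip c f" and k: "0 < k"
  shows "rel_lip c (\<lambda>x. f x / k)"
proof (rule rel_lipI)
  fix x y :: real assume xy: "x \<in> {0..1}" "y \<in> {0..1}"
  have "\<bar>f x / k - f y / k\<bar> = \<bar>f x - f y\<bar> / k"
    using k by (simp flip: diff_divide_distrib)
  also have "\<dots> \<le> c * \<bar>x - y\<bar> * f y / k"
    using rel_lipD[OF f xy] k by (intro divide_right_mono) auto
  finally show "\<bar>f x / k - f y / k\<bar> \<le> c * \<bar>x - y\<bar> * (f y / k)" by simp
qed (use rel_lip_pos[OF f] k in auto)

text \<open>The product rule gives \<open>a + c\<close>; the extra \<open>a * c\<close> is the price
  of replacing \<open>g x\<close> by \<open>(1 + c) * g y\<close>. With \<open>a = 3/2000\<close>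
  and \<open>c = 1/100\<close> the result is below 3/250, the constant assumed of the weights
  below.\<close>

lemma rel_lip_mult:
  assumes f: "rel_lip a f" and g: "rel_lip c g"
  shows "rel_lip (a + c + a * c) (\<lambda>x. f x * g x)"
proof (rule rel_lipI)
  fix x y :: real assume xy: "x \<in> {0..1}" "y \<in> {0..1}"
  have "\<bar>f x * g x - f y * g y\<bar> = \<bar>(f x - f y) * g x + f y * (g x - g y)\<bar>"
    by (simp add: algebra_simps)
  also have "\<dots> \<le> \<bar>f x - f y\<bar> * g x + f y * \<bar>g x - g y\<bar>"
    using rel_lip_pos[OF f xy(2)] rel_lip_pos[OF g xy(1)]
    by (metis abs_mult abs_of_pos abs_triangle_ineq)
  also have "\<dots> \<le> (a * \<bar>x - y\<bar> * f y) * ((1 + c) * g y) + f y * (c * \<bar>x - y\<bar> * g y)"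
    using rel_lipD[OF f xy] rel_lipD[OF g xy] rel_lip_le[OF g xy] rel_lip_nonneg[OF f]
      rel_lip_pos[OF f xy(2)] rel_lip_pos[OF g xy(1)]
    by (intro add_mono mult_mono) (auto intro!: mult_nonneg_nonneg)
  finally show "\<bar>f x * g x - f y * g y\<bar> \<le> (a + c + a * c) * \<bar>x - y\<bar> * (f y * g y)"
    by (simp add: algebra_simps)
qed (use rel_lip_pos[OF f] rel_lip_pos[OF g] in auto)

lemma rel_lip_lipschitz:
  assumes f: "rel_lip c f"
  shows "(c * ((1 + c) * f 0))-lipschitz_on {0..1} f"
proof (rule lipschitz_onI)
  fix x y :: real assume xy: "x \<in> {0..1}" "y \<in> {0..1}"
  have "\<bar>f x - f y\<bar> \<le> (c * \<bar>x - y\<bar>) * f y" using rel_lipD[OF f xy] by simp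
  also have "\<dots> \<le> (c * \<bar>x - y\<bar>) * ((1 + c) * f 0)"
    using rel_lip_nonneg[OF f] by (intro mult_left_mono rel_lip_le[OF f xy(2)]) auto
  finally show "dist (f x) (f y) \<le> c * ((1 + c) * f 0) * dist x y"
    by (simp add: dist_real_def mult_ac)
qed (use rel_lip_nonneg[OF f] rel_lip_pos[OF f, of 0] in auto)

text \<open>The relative bound on \<open>h\<close> absorbs the denominator \<open>h y\<close>, so
  only one factor \<open>1 / m\<close> is lost.\<close>

lemma lipschitz_on_divide_rel_lip:
  assumes f: "C-lipschitz_on {0..1} f" and B: "\<And>x. x \<in> {0..1} \<Longrightarrow> \<bar>f x\<bar> \<le> B"
    and h: "rel_lip c h" and m: "0 < m" "\<And>x. x \<in> {0..1} \<Longrightarrow> m \<le> h x"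
  shows "((C + B * c) / m)-lipschitz_on {0..1} (\<lambda>x. f x / h x)"
proof (rule lipschitz_onI)
  have B0: "0 \<le> B" using B[of 0] by simp
  note c0 = rel_lip_nonneg[OF h]
  note C0 = lipschitz_on_nonneg[OF f]
  show "0 \<le> (C + B * c) / m" using B0 c0 C0 m by simp
  fix x y :: real assume xy: "x \<in> {0..1}" "y \<in> {0..1}"
  have hx: "0 < h x" and hy: "0 < h y" using rel_lip_pos[OF h] xy by auto
  have "f x / h x - f y / h y = ((f x - f y) - f y * ((h x - h y) / h y)) / h x"
    using hx hy by (simp add: field_simps)
  hence "\<bar>f x / h x - f y / h y\<bar> = \<bar>(f x - f y) - f y * ((h x - h y) / h y)\<bar> / h x"
    using hx by simp
  also have "\<dots> \<le> (C * \<bar>x - y\<bar> + B * (c * \<bar>x - y\<bar>)) / m"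
  proof (intro frac_le)
    have "\<bar>(h x - h y) / h y\<bar> \<le> c * \<bar>x - y\<bar>"
      using rel_lipD[OF h xy] hy by (simp add: divide_le_eq)
    hence "\<bar>f y * ((h x - h y) / h y)\<bar> \<le> B * (c * \<bar>x - y\<bar>)"
      unfolding abs_mult using B[OF xy(2)] B0 by (intro mult_mono) auto
    moreover have "\<bar>f x - f y\<bar> \<le> C * \<bar>x - y\<bar>"
      using lipschitz_onD[OF f xy] by (simp add: dist_real_def)
    ultimately show "\<bar>(f x - f y) - f y * ((h x - h y) / h y)\<bar> \<le> C * \<bar>x - y\<bar> + B * (c * \<bar>x - y\<bar>)"
      by linarith
    show "0 \<le> C * \<bar>x - y\<bar> + B * (c * \<bar>x - y\<bar>)" using B0 C0 c0 by simp
  qed (use m xy in auto)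
  finally show "dist (f x / h x) (f y / h y) \<le> (C + B * c) / m * dist x y"
    by (simp add: dist_real_def algebra_simps)
qed

text \<open>With t at most 0.0014 times the distance, \<open>exp t - 1\<close> is at most
  \<open>t + t^2\<close>, hence at most 0.00140196 times the distance; 3/2000 leaves room.\<close>

lemma rel_lip_exp:
  assumes f: "is_lip01 f" and c: "lip_const f \<le> 7/5000"
  shows "rel_lip (3/2000) (\<lambda>x. exp (f x))"
proof (rule rel_lipI)
  fix x y :: real assume xy: "x \<in> {0..1}" "y \<in> {0..1}"
  define t where "t = \<bar>f x - f y\<bar>"
  have "\<bar>f x - f y\<bar> \<le> lip_const f * \<bar>x - y\<bar>" using lip_const_upper[OF f xy] .
  also have "\<dots> \<le> 7/5000 * \<bar>x - y\<bar>" using c by (intro mult_right_mono) auto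
  finally have t: "0 \<le> t" "t \<le> 7/5000 * \<bar>x - y\<bar>" unfolding t_def by auto
  have "7/5000 * \<bar>x - y\<bar> \<le> 7/5000 * 1" using xy by (intro mult_left_mono) auto
  with t have t1: "t \<le> 7/5000" by simp
  have "exp t \<le> 1 + t + t\<^sup>2" using t t1 by (intro exp_bound) auto
  moreover have "t\<^sup>2 \<le> 7/5000 * t" using mult_right_mono[OF t1 t(1)] by (simp add: power2_eq_square)
  ultimately have e: "exp t - 1 \<le> 3/2000 * \<bar>x - y\<bar>" using t by linarith
  \<comment> \<open>For a negative exponent, \<open>1 - exp (- t)\<close> is at most
    \<open>t\<close>, which is at most \<open>exp t - 1\<close>.\<close>
  have "\<bar>exp (f x - f y) - 1\<bar> \<le> exp t - 1"
  proof (cases "f x \<le> f y")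
    case True
    hence "exp (f x - f y) \<le> 1" by simp
    moreover have "1 + (f x - f y) \<le> exp (f x - f y)" "1 + t \<le> exp t"
      by (rule exp_ge_add_one_self)+
    moreover have "t = f y - f x" using True by (simp add: t_def)
    ultimately show ?thesis by linarith
  qed (simp add: t_def)
  hence "exp (f y) * \<bar>exp (f x - f y) - 1\<bar> \<le> exp (f y) * (3/2000 * \<bar>x - y\<bar>)"
    using e by (intro mult_left_mono) auto
  moreover have "exp (f x) - exp (f y) = exp (f y) * (exp (f x - f y) - 1)"
    by (simp add: algebra_simps flip: exp_add)
  ultimately show "\<bar>exp (f x) - exp (f y)\<bar> \<le> 3/2000 * \<bar>x - y\<bar> * exp (f y)"
    by (simp add: abs_mult mult_ac)
qed simp

section \<open>Averages over two inverse branches\<close>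

text \<open>The left branch of the Pommeau-Manneville map has derivative 1 at the neutral fixed
  point 0, so no factor below 1 can be asked of \<open>b1\<close>; all contraction comes from
  \<open>b2\<close>.\<close>

locale inverse_branches =
  fixes b1 b2 :: "real \<Rightarrow> real"
  assumes b1_in: "x \<in> {0..1} \<Longrightarrow> b1 x \<in> {0..1}"
    and b2_in: "x \<in> {0..1} \<Longrightarrow> b2 x \<in> {0..1}"
    and b1_lip: "x \<in> {0..1} \<Longrightarrow> y \<in> {0..1} \<Longrightarrow> \<bar>b1 x - b1 y\<bar> \<le> \<bar>x - y\<bar>"
    and b2_lip: "x \<in> {0..1} \<Longrightarrow> y \<in> {0..1} \<Longrightarrow> \<bar>b2 x - b2 y\<bar> \<le> \<bar>x - y\<bar> / 2"
begin

text \<open>For \<open>F = W * g\<close> this is the transfer operator with weight \<open>W\<close>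
  applied to \<open>g * f\<close>, divided by the same operator applied to \<open>g\<close>.\<close>

definition avg :: "(real \<Rightarrow> real) \<Rightarrow> (real \<Rightarrow> real) \<Rightarrow> real \<Rightarrow> real" where
  "avg F f x = (F (b1 x) * f (b1 x) + F (b2 x) * f (b2 x)) / (F (b1 x) + F (b2 x))"

section \<open>Regularity and contraction from one step along the branches\<close>

lemma rel_lip_b1:
  assumes "rel_lip c F" "x \<in> {0..1}" "y \<in> {0..1}"
  shows "\<bar>F (b1 x) - F (b1 y)\<bar> \<le> c * \<bar>x - y\<bar> * F (b1 y)"
proof -
  have "c * \<bar>b1 x - b1 y\<bar> * F (b1 y) \<le> c * \<bar>x - y\<bar> * F (b1 y)"
    using rel_lip_nonneg[OF assms(1)] rel_lip_pos[OF assms(1) b1_in[OF assms(3)]]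
    by (intro mult_right_mono mult_left_mono b1_lip assms) auto
  thus ?thesis using rel_lipD[OF assms(1) b1_in[OF assms(2)] b1_in[OF assms(3)]] by linarith
qed

lemma rel_lip_b2:
  assumes "rel_lip c F" "x \<in> {0..1}" "y \<in> {0..1}"
  shows "\<bar>F (b2 x) - F (b2 y)\<bar> \<le> c * (\<bar>x - y\<bar> / 2) * F (b2 y)"
proof -
  have "c * \<bar>b2 x - b2 y\<bar> * F (b2 y) \<le> c * (\<bar>x - y\<bar> / 2) * F (b2 y)"
    using rel_lip_nonneg[OF assms(1)] rel_lip_pos[OF assms(1) b2_in[OF assms(3)]]
    by (intro mult_right_mono mult_left_mono b2_lip assms) auto
  thus ?thesis using rel_lipD[OF assms(1) b2_in[OF assms(2)] b2_in[OF assms(3)]] by linarith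
qed

text \<open>The left branch contributes 3/250 and the right one half of that. Since
  \<open>F (b1 y)\<close> is less than twice \<open>F (b2 y)\<close>, the weighted mean is at most
  1/100. Together with \<open>rel_lip_mult\<close> this makes the constant 1/100 invariant.\<close>

lemma rel_lip_branch_sum:
  assumes F: "rel_lip (3/250) F"
  shows "rel_lip (1/100) (\<lambda>x. 1/2 * (F (b1 x) + F (b2 x)))"
proof (rule rel_lipI)
  fix x y :: real assume xy: "x \<in> {0..1}" "y \<in> {0..1}"
  have "F (b1 y) \<le> (1 + 3/250) * F (b2 y)"
    by (rule rel_lip_le[OF F b1_in[OF xy(2)] b2_in[OF xy(2)]])
  moreover have "0 < F (b2 y)" using rel_lip_pos[OF F] b2_in xy by auto
  ultimately have "3/250 * F (b1 y) + 3/500 * F (b2 y) \<le> 1/100 * (F (b1 y) + F (b2 y))"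
    by argo
  hence "\<bar>x - y\<bar> * (3/250 * F (b1 y) + 3/500 * F (b2 y)) \<le> \<bar>x - y\<bar> * (1/100 * (F (b1 y) + F (b2 y)))"
    by (intro mult_left_mono) auto
  hence "3/250 * \<bar>x - y\<bar> * F (b1 y) + 3/250 * (\<bar>x - y\<bar> / 2) * F (b2 y)
      \<le> 1/100 * \<bar>x - y\<bar> * (F (b1 y) + F (b2 y))"
    by (simp add: algebra_simps)
  hence "\<bar>F (b1 x) - F (b1 y)\<bar> + \<bar>F (b2 x) - F (b2 y)\<bar>
      \<le> 1/100 * \<bar>x - y\<bar> * (F (b1 y) + F (b2 y))"
    using rel_lip_b1[OF F xy] rel_lip_b2[OF F xy] by linarith
  moreover have "\<bar>1/2 * (F (b1 x) + F (b2 x)) - 1/2 * (F (b1 y) + F (b2 y))\<bar>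
      \<le> 1/2 * (\<bar>F (b1 x) - F (b1 y)\<bar> + \<bar>F (b2 x) - F (b2 y)\<bar>)"
    by argo
  ultimately show "\<bar>1/2 * (F (b1 x) + F (b2 x)) - 1/2 * (F (b1 y) + F (b2 y))\<bar>
      \<le> 1/100 * \<bar>x - y\<bar> * (1/2 * (F (b1 y) + F (b2 y)))"
    by (simp add: algebra_simps)
next
  fix x :: real assume "x \<in> {0..1}"
  thus "0 < 1/2 * (F (b1 x) + F (b2 x))"
    using rel_lip_pos[OF F] b1_in b2_in by (simp add: add_pos_pos)
qed

text \<open>Convexity. The free centre \<open>k\<close> serves three purposes: sup bounds
  (\<open>k = 0\<close>), closeness to a reference value, and preservation of constants
  (\<open>s = 0\<close>).\<close>

lemma avg_bound:
  assumes F: "rel_lip c F" and f: "\<And>x. x \<in> {0..1} \<Longrightarrow> \<bar>f x - k\<bar> \<le> s" and x: "x \<in> {0..1}"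
  shows "\<bar>avg F f x - k\<bar> \<le> s"
proof -
  have p: "0 < F (b1 x)" "0 < F (b2 x)" using rel_lip_pos[OF F] b1_in b2_in x by auto
  have "avg F f x - k = (F (b1 x) * (f (b1 x) - k) + F (b2 x) * (f (b2 x) - k)) / (F (b1 x) + F (b2 x))"
    using p by (simp add: avg_def field_simps)
  also have "\<bar>\<dots>\<bar> = \<bar>F (b1 x) * (f (b1 x) - k) + F (b2 x) * (f (b2 x) - k)\<bar> / (F (b1 x) + F (b2 x))"
    using p by simp
  also have "\<dots> \<le> (F (b1 x) * s + F (b2 x) * s) / (F (b1 x) + F (b2 x))"
  proof (intro divide_right_mono order.trans[OF abs_triangle_ineq] add_mono)
    show "\<bar>F (b1 x) * (f (b1 x) - k)\<bar> \<le> F (b1 x) * s" "\<bar>F (b2 x) * (f (b2 x) - k)\<bar> \<le> F (b2 x) * s"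
      using p f b1_in b2_in x by (auto simp: abs_mult)
  qed (use p in auto)
  also have "\<dots> = s" using p by (simp add: field_simps)
  finally show ?thesis .
qed

text \<open>The right branch carries nearly half of the weight and halves distances, which saves
  almost a quarter of \<open>K\<close>; the variation of the weights costs only 3/250.\<close>

lemma avg_lipschitz:
  assumes F: "rel_lip (3/250) F" and f: "K-lipschitz_on {0..1} f"
  shows "(4/5 * K)-lipschitz_on {0..1} (avg F f)"
proof (rule lipschitz_onI)
  have K: "0 \<le> K" by (rule lipschitz_on_nonneg[OF f])
  thus "0 \<le> 4/5 * K" by simp
  fix x y :: real assume xy: "x \<in> {0..1}" "y \<in> {0..1}"
  define d where "d = \<bar>x - y\<bar>"
  define u v u' v' where uv: "u = F (b1 x)" "v = F (b2 x)" "u' = F (b1 y)" "v' = F (b2 y)"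
  have p: "0 < u" "0 < v" "0 < u'" "0 < v'"
    using rel_lip_pos[OF F] b1_in b2_in xy by (auto simp: uv)
  have d: "0 \<le> d" by (simp add: d_def)
  define p q p' where pq: "p = u / (u + v)" "q = v / (u + v)" "p' = u' / (u' + v')"
  have p0: "0 \<le> p" "0 \<le> q" "p + q = 1" using p by (auto simp: pq simp flip: add_divide_distrib)
  have "u \<le> (1 + 3/250) * v"
    unfolding uv by (rule rel_lip_le[OF F b1_in[OF xy(1)] b2_in[OF xy(1)]])
  \<comment> \<open>The exact bound is 1/2.012.\<close>
  hence q: "49/100 \<le> q" using p by (simp add: pq field_simps)
  \<comment> \<open>The numerator of \<open>p - p'\<close> is \<open>u * v' - u' * v\<close>;
    inserting \<open>u' * v'\<close> expresses it through the changes of the weights.\<close>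
  have pp: "\<bar>p - p'\<bar> \<le> 3/250 * d"
  proof -
    have "\<bar>u - u'\<bar> \<le> 3/250 * d * u" "\<bar>v - v'\<bar> \<le> 3/250 * (d / 2) * v"
      using rel_lip_b1[OF F xy(2,1)] rel_lip_b2[OF F xy(2,1)]
      by (simp_all add: uv d_def abs_minus_commute)
    hence "\<bar>u - u'\<bar> * v' \<le> 3/250 * d * u * v'" "u' * \<bar>v - v'\<bar> \<le> u' * (3/250 * (d / 2) * v)"
      using p by (auto intro: mult_right_mono mult_left_mono)
    moreover have "\<bar>(u - u') * v' - u' * (v - v')\<bar> \<le> \<bar>u - u'\<bar> * v' + u' * \<bar>v - v'\<bar>"
      using p by (intro order.trans[OF abs_triangle_ineq4]) (simp add: abs_mult)
    moreover have "0 \<le> d * (u' * v)" "0 \<le> d * (u * u')" "0 \<le> d * (v * v')" "0 \<le> d * (u * v')"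
      using p d by auto
    ultimately have "\<bar>(u - u') * v' - u' * (v - v')\<bar> \<le> 3/250 * d * ((u + v) * (u' + v'))"
      by (simp add: algebra_simps)
    moreover have "p - p' = ((u - u') * v' - u' * (v - v')) / ((u + v) * (u' + v'))"
      using p by (simp add: pq field_simps)
    ultimately show ?thesis using p by (simp add: divide_le_eq abs_mult)
  qed
  define f1 f2 f1' f2' where ff: "f1 = f (b1 x)" "f2 = f (b2 x)" "f1' = f (b1 y)" "f2' = f (b2 y)"
  have L: "\<bar>f s - f t\<bar> \<le> K * \<bar>s - t\<bar>" if "s \<in> {0..1}" "t \<in> {0..1}" for s t
    using lipschitz_onD[OF f that] by (simp add: dist_real_def)
  have e1: "\<bar>f1 - f1'\<bar> \<le> K * d"
    unfolding ff d_def using xy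
    by (intro order.trans[OF L] mult_left_mono K b1_lip b1_in)
  have e2: "\<bar>f2 - f2'\<bar> \<le> K * (d / 2)"
    unfolding ff d_def using xy
    by (intro order.trans[OF L] mult_left_mono K b2_lip b2_in)
  have e3: "\<bar>f1' - f2'\<bar> \<le> K * 1"
    unfolding ff using xy b1_in[OF xy(2)] b2_in[OF xy(2)]
    by (intro order.trans[OF L] mult_left_mono K b1_in b2_in) auto
  \<comment> \<open>The values change along each branch with the weights frozen at \<open>x\<close>.
    The weights sum to one, so their change meets only the gap \<open>f1' - f2'\<close> between the
    branches.\<close>
  have "avg F f x - avg F f y = p * (f1 - f1') + q * (f2 - f2') + (p - p') * (f1' - f2')"
  proof -
    have "avg F f x = p * f1 + q * f2" "avg F f y = p' * f1' + (v' / (u' + v')) * f2'"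
      by (simp_all add: avg_def pq ff uv add_divide_distrib)
    moreover have "q = 1 - p" using p0 by simp
    moreover have "v' / (u' + v') = 1 - p'"
      using p by (simp add: pq eq_diff_eq flip: add_divide_distrib)
    ultimately show ?thesis by (simp only:) (simp add: algebra_simps)
  qed
  also have "\<bar>\<dots>\<bar> \<le> \<bar>p * (f1 - f1')\<bar> + \<bar>q * (f2 - f2')\<bar> + \<bar>(p - p') * (f1' - f2')\<bar>"
    by linarith
  also have "\<dots> \<le> p * (K * d) + q * (K * (d / 2)) + (3/250 * d) * (K * 1)"
    unfolding abs_mult using p0 e1 e2 e3 pp d by (intro add_mono mult_mono) auto
  also have "\<dots> = (1 - q / 2 + 3/250) * (K * d)"
    using p0(3) by (simp add: algebra_simps flip: eq_diff_eq)
  \<comment> \<open>With \<open>q\<close> at least 0.49 the factor is at most 0.767.\<close>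
  also have "\<dots> \<le> 4/5 * (K * d)"
    using q K d by (intro mult_right_mono) auto
  finally show "dist (avg F f x) (avg F f y) \<le> 4/5 * K * dist x y"
    by (simp add: dist_real_def d_def)
qed

section \<open>Iterates of the averaging operator and their constant limits\<close>

lemma avg_cong:
  assumes "\<And>x. x \<in> {0..1} \<Longrightarrow> f x = g x" "x \<in> {0..1}"
  shows "avg F f x = avg F g x"
  using assms b1_in b2_in by (simp add: avg_def)

lemma avg_power_cong:
  assumes "\<And>x. x \<in> {0..1} \<Longrightarrow> f x = g x" "x \<in> {0..1}"
  shows "(avg F ^^ n) f x = (avg F ^^ n) g x"
  using assms by (induction n arbitrary: x) (auto intro: avg_cong)

lemma avg_power_add: "(avg F ^^ n) (\<lambda>x. f x + g x) = (\<lambda>x. (avg F ^^ n) f x + (avg F ^^ n) g x)"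
  by (induction n) (auto simp: avg_def fun_eq_iff algebra_simps simp flip: add_divide_distrib)

lemma avg_power_cmult: "(avg F ^^ n) (\<lambda>x. k * f x) = (\<lambda>x. k * (avg F ^^ n) f x)"
  by (induction n) (auto simp: avg_def fun_eq_iff algebra_simps)

lemma avg_power_bound:
  assumes "rel_lip c F" "\<And>x. x \<in> {0..1} \<Longrightarrow> \<bar>f x - k\<bar> \<le> s" "x \<in> {0..1}"
  shows "\<bar>(avg F ^^ n) f x - k\<bar> \<le> s"
  using assms(2,3) by (induction n arbitrary: x) (auto intro!: avg_bound[OF assms(1)])

lemma avg_power_lipschitz:
  assumes "rel_lip (3/250) F" "K-lipschitz_on {0..1} f"
  shows "((4/5) ^ n * K)-lipschitz_on {0..1} ((avg F ^^ n) f)"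
proof (induction n)
  case (Suc n)
  from avg_lipschitz[OF assms(1) this] show ?case by (simp add: mult.assoc)
qed (use assms(2) in simp)

text \<open>After \<open>n\<close> steps the oscillation is at most \<open>(4/5)^n * K\<close>, and
  the \<open>m\<close> further averages cannot leave an interval containing all the values.\<close>

lemma avg_power_diff:
  assumes F: "rel_lip (3/250) F" and f: "K-lipschitz_on {0..1} f" and x: "x \<in> {0..1}" and y: "y \<in> {0..1}"
  shows "\<bar>(avg F ^^ (m + n)) f x - (avg F ^^ n) f y\<bar> \<le> (4/5) ^ n * K"
proof -
  let ?K = "(4/5) ^ n * K"
  have L: "?K-lipschitz_on {0..1} ((avg F ^^ n) f)" by (rule avg_power_lipschitz[OF F f])
  have "\<bar>(avg F ^^ n) f z - (avg F ^^ n) f y\<bar> \<le> ?K" if z: "z \<in> {0..1}" for z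
  proof -
    have "\<bar>(avg F ^^ n) f z - (avg F ^^ n) f y\<bar> \<le> ?K * \<bar>z - y\<bar>"
      using lipschitz_onD[OF L z y] by (simp add: dist_real_def)
    also have "\<dots> \<le> ?K * 1"
      using lipschitz_on_nonneg[OF L] z y by (intro mult_left_mono) auto
    finally show ?thesis by simp
  qed
  thus ?thesis unfolding funpow_add o_def by (rule avg_power_bound[OF F _ x])
qed

lemma avg_power_convergent:
  assumes F: "rel_lip (3/250) F" and f: "K-lipschitz_on {0..1} f"
  shows "convergent (\<lambda>n. (avg F ^^ n) f 0)"
proof -
  have "Cauchy (\<lambda>n. (avg F ^^ n) f 0)"
    unfolding Cauchy_altdef2
  proof (intro allI impI)
    fix e :: real assume "0 < e"
    have "(\<lambda>n. (4/5) ^ n * K) \<longlonglongrightarrow> 0 * K"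
      by (intro tendsto_intros LIMSEQ_power_zero) auto
    hence "\<forall>\<^sub>F n in sequentially. (4/5) ^ n * K < e"
      using \<open>0 < e\<close> by (intro order_tendstoD(2)) auto
    then obtain N where N: "(4/5) ^ N * K < e" by (auto simp: eventually_sequentially)
    show "\<exists>N. \<forall>n\<ge>N. dist ((avg F ^^ n) f 0) ((avg F ^^ N) f 0) < e"
    proof (intro exI[of _ N] allI impI)
      fix n assume "N \<le> n"
      then obtain m where "n = m + N" by (metis le_iff_add add.commute)
      thus "dist ((avg F ^^ n) f 0) ((avg F ^^ N) f 0) < e"
        using avg_power_diff[OF F f, of 0 0 m N] N by (simp add: dist_real_def)
    qed
  qed
  thus ?thesis by (simp add: Cauchy_convergent_iff)
qed

text \<open>Let \<open>m\<close> tend to infinity in \<open>avg_power_diff\<close>: the limit at the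
  single point 0 is the uniform limit on the whole interval.\<close>

lemma avg_power_limit_diff:
  assumes F: "rel_lip (3/250) F" and f: "K-lipschitz_on {0..1} f" and x: "x \<in> {0..1}"
    and l: "(\<lambda>n. (avg F ^^ n) f 0) \<longlonglongrightarrow> l"
  shows "\<bar>(avg F ^^ n) f x - l\<bar> \<le> (4/5) ^ n * K"
proof (rule tendsto_upperbound)
  have "(\<lambda>m. (avg F ^^ (m + n)) f 0) \<longlonglongrightarrow> l" using l by (rule LIMSEQ_ignore_initial_segment)
  thus "(\<lambda>m. \<bar>(avg F ^^ n) f x - (avg F ^^ (m + n)) f 0\<bar>) \<longlonglongrightarrow> \<bar>(avg F ^^ n) f x - l\<bar>"
    by (intro tendsto_intros)
  show "\<forall>\<^sub>F m in sequentially. \<bar>(avg F ^^ n) f x - (avg F ^^ (m + n)) f 0\<bar> \<le> (4/5) ^ n * K"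
    using avg_power_diff[OF F f _ x, of 0 _ n] by (simp add: abs_minus_commute)
qed simp


section \<open>Construction of a positive eigenfunction by power iteration\<close>

lemma eigenfunction:
  assumes W: "rel_lip (3/2000) W"
  obtains h lam where "0 < lam" "rel_lip (1/100) h" "h 0 = 1"
    "\<And>x. x \<in> {0..1} \<Longrightarrow> 1/2 * (W (b1 x) * h (b1 x) + W (b2 x) * h (b2 x)) = lam * h x"
proof -
  define tr where "tr g x = 1/2 * (W (b1 x) * g (b1 x) + W (b2 x) * g (b2 x))" for g x
  define g where "g n = ((\<lambda>u x. tr u x / tr u 0) ^^ n) (\<lambda>_. 1)" for n
  define r where "r n x = tr (g n) x / g n x" for n x
  have Wu: "rel_lip (3/250) (\<lambda>x. W x * u x)" if "rel_lip (1/100) u" for u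
    by (rule rel_lip_mono[OF rel_lip_mult[OF W that]]) simp
  have tr: "rel_lip (1/100) (tr u)" if "rel_lip (1/100) u" for u
    using rel_lip_branch_sum[OF Wu[OF that]] unfolding tr_def .
  have g_Suc: "g (Suc n) = (\<lambda>x. tr (g n) x / tr (g n) 0)" for n by (simp add: g_def)
  have g: "rel_lip (1/100) (g n)" for n
  proof (induction n)
    case 0
    show ?case by (rule rel_lipI) (auto simp: g_def)
  next
    case (Suc n)
    have "rel_lip (1/100) (\<lambda>x. tr (g n) x / tr (g n) 0)"
      using tr[OF Suc] by (intro rel_lip_divide_const) (auto intro: rel_lip_pos)
    thus ?case by (simp only: g_Suc)
  qed
  have tr_pos: "0 < tr (g n) x" if "x \<in> {0..1}" for n x using rel_lip_pos[OF tr[OF g] that] .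
  have g_pos: "0 < g n x" if "x \<in> {0..1}" for n x using rel_lip_pos[OF g that] .
  have g0: "g n 0 = 1" for n
    using tr_pos[of 0 "n - 1"] by (cases n) (auto simp: g_Suc g_def[of 0])
  have g_ge: "1 \<le> (1 + 1/100) * g n x" if "x \<in> {0..1}" for n x
    using rel_lip_le[OF g _ that, of 0 n] g0[of n] by simp
  have g_le: "g n x \<le> 1 + 1/100" if "x \<in> {0..1}" for n x
    using rel_lip_le[OF g that, of 0 n] g0[of n] by simp
  \<comment> \<open>The normalising factor \<open>tr (g n) 0\<close> cancels. The weight changes
    with \<open>n\<close>, but its relative constant stays below 3/250, so every step contracts by
    the same 4/5.\<close>
  have r_Suc: "r (Suc n) x = avg (\<lambda>x. W x * g n x) (r n) x" if x: "x \<in> {0..1}" for n x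
  proof -
    have p: "0 < W (b1 x) * g n (b1 x)" "0 < W (b2 x) * g n (b2 x)"
      "0 < g n (b1 x)" "0 < g n (b2 x)" "0 < tr (g n) 0"
      using rel_lip_pos[OF Wu[OF g]] g_pos tr_pos b1_in b2_in x by auto
    have "tr (g (Suc n)) x = 1/2 * (W (b1 x) * tr (g n) (b1 x) + W (b2 x) * tr (g n) (b2 x)) / tr (g n) 0"
      by (subst tr_def) (simp add: g_Suc add_divide_distrib)
    hence "r (Suc n) x = 1/2 * (W (b1 x) * tr (g n) (b1 x) + W (b2 x) * tr (g n) (b2 x)) / tr (g n) x"
      unfolding r_def g_Suc using p by simp
    also have "\<dots> = (W (b1 x) * tr (g n) (b1 x) + W (b2 x) * tr (g n) (b2 x)) /
        (W (b1 x) * g n (b1 x) + W (b2 x) * g n (b2 x))"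
      unfolding tr_def[of "g n" x] by (rule mult_divide_mult_cancel_left) simp
    also have "\<dots> = avg (\<lambda>x. W x * g n x) (r n) x"
      using p by (simp add: avg_def r_def)
    finally show ?thesis .
  qed
  obtain K where K: "K-lipschitz_on {0..1} (r 0)"
    using rel_lip_lipschitz[OF tr[OF g, of 0]] by (force simp: r_def g_def)
  have r_lip: "((4/5) ^ n * K)-lipschitz_on {0..1} (r n)" for n
  proof (induction n)
    case (Suc n)
    have "(4/5 * ((4/5) ^ n * K))-lipschitz_on {0..1} (avg (\<lambda>x. W x * g n x) (r n))"
      by (rule avg_lipschitz[OF Wu[OF g] Suc])
    hence "(4/5 * ((4/5) ^ n * K))-lipschitz_on {0..1} (r (Suc n))"
      by (rule lipschitz_on_transform) (simp add: r_Suc)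
    thus ?case by (simp add: mult.assoc)
  qed (use K in simp)
  \<comment> \<open>Product of the lower bounds for \<open>W\<close> and \<open>g n\<close> on the
    interval, both obtained by comparison with the point 0.\<close>
  define m where "m = W 0 / (1 + 3/2000) / (1 + 1/100)"
  have m: "0 < m" using rel_lip_pos[OF W, of 0] by (simp add: m_def)
  have tr_ge: "m \<le> tr (g n) 0" for n
  proof -
    have "m \<le> W z * g n z" if z: "z \<in> {0..1}" for z
    proof -
      have "W 0 / (1 + 3/2000) \<le> W z" using rel_lip_le[OF W _ z, of 0] by simp
      moreover have "1 / (1 + 1/100) \<le> g n z" using g_ge[OF z, of n] by simp
      ultimately have "W 0 / (1 + 3/2000) * (1 / (1 + 1/100)) \<le> W z * g n z"
        using rel_lip_pos[OF W z] by (intro mult_mono) auto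
      thus ?thesis by (simp add: m_def)
    qed
    from this[OF b1_in, of 0] this[OF b2_in, of 0] show ?thesis by (simp add: tr_def)
  qed
  have g_diff: "\<bar>g (Suc n) x - g n x\<bar> \<le> (1 + 1/100) * K / m * (4/5) ^ n" if x: "x \<in> {0..1}" for n x
  proof -
    \<comment> \<open>Because \<open>g n 0 = 1\<close>, \<open>r n 0\<close> equals
      \<open>tr (g n) 0\<close>, so the increment is controlled by the oscillation of
      \<open>r n\<close>.\<close>
    have "g (Suc n) x - g n x = g n x * (r n x - r n 0) / tr (g n) 0"
      using tr_pos[of 0 n] g_pos[OF x, of n] by (simp add: r_def g_Suc g0 field_simps)
    hence "\<bar>g (Suc n) x - g n x\<bar> = g n x * \<bar>r n x - r n 0\<bar> / tr (g n) 0"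
      using tr_pos[of 0 n] g_pos[OF x, of n] by (simp add: abs_mult)
    also have "\<dots> \<le> (1 + 1/100) * ((4/5) ^ n * K * 1) / m"
    proof (intro frac_le mult_mono g_le x tr_ge m)
      have "\<bar>r n x - r n 0\<bar> \<le> (4/5) ^ n * K * \<bar>x\<bar>"
        using lipschitz_onD[OF r_lip x, of 0 n] by (simp add: dist_real_def)
      also have "\<dots> \<le> (4/5) ^ n * K * 1"
        using x lipschitz_on_nonneg[OF r_lip[of n]] by (intro mult_left_mono) auto
      finally show "\<bar>r n x - r n 0\<bar> \<le> (4/5) ^ n * K * 1" .
    qed (use lipschitz_on_nonneg[OF K] in auto)
    finally show ?thesis by (simp add: mult_ac)
  qed
  define h where "h x = lim (\<lambda>n. g n x)" for x
  have lim: "(\<lambda>n. g n x) \<longlonglongrightarrow> h x" if x: "x \<in> {0..1}" for x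
  proof -
    have "summable (\<lambda>n. (1 + 1/100) * K / m * (4/5) ^ n)"
      by (intro summable_mult summable_geometric) simp
    hence "summable (\<lambda>n. g (Suc n) x - g n x)"
      by (rule summable_comparison_test'[where N = 0]) (use g_diff[OF x] in simp)
    hence "convergent (\<lambda>n. g n x - g 0 x)"
      using sum_lessThan_telescope[of "\<lambda>n. g n x"] by (simp add: summable_iff_convergent)
    hence "convergent (\<lambda>n. (g n x - g 0 x) + g 0 x)"
      by (intro convergent_add convergent_const)
    thus ?thesis by (simp add: h_def convergent_LIMSEQ_iff)
  qed
  have h: "rel_lip (1/100) h"
  proof (rule rel_lipI)
    fix x :: real assume x: "x \<in> {0..1}"
    \<comment> \<open>Strict positivity may be lost in a limit; the lower bound uniform in
      \<open>n\<close> is not.\<close>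
    have "1 \<le> (1 + 1/100) * h x"
      by (rule tendsto_lowerbound[OF tendsto_mult_left[OF lim[OF x]]]) (use g_ge[OF x] in auto)
    thus "0 < h x" by simp
    fix y :: real assume y: "y \<in> {0..1}"
    show "\<bar>h x - h y\<bar> \<le> 1/100 * \<bar>x - y\<bar> * h y"
    proof (rule LIMSEQ_le)
      show "(\<lambda>n. \<bar>g n x - g n y\<bar>) \<longlonglongrightarrow> \<bar>h x - h y\<bar>"
        by (intro tendsto_intros lim x y)
      show "(\<lambda>n. 1/100 * \<bar>x - y\<bar> * g n y) \<longlonglongrightarrow> 1/100 * \<bar>x - y\<bar> * h y"
        by (intro tendsto_intros lim y)
    qed (use rel_lipD[OF g x y] in blast)
  qed
  have tr_lim: "(\<lambda>n. tr (g n) x) \<longlonglongrightarrow> tr h x" if "x \<in> {0..1}" for x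
    unfolding tr_def by (intro tendsto_intros lim b1_in b2_in that)
  show thesis
  proof (rule that)
    show "0 < tr h 0" using rel_lip_pos[OF tr[OF h], of 0] by simp
    show "h 0 = 1" using LIMSEQ_unique[OF lim[of 0]] g0 by simp
    fix x :: real assume x: "x \<in> {0..1}"
    \<comment> \<open>Clearing the denominator in \<open>g_Suc\<close> and passing to the limit
      identifies the eigenvalue as \<open>tr h 0\<close>.\<close>
    have "(\<lambda>n. tr (g n) 0 * g (Suc n) x) \<longlonglongrightarrow> tr h 0 * h x"
      using LIMSEQ_Suc[OF lim[OF x]] by (intro tendsto_intros tr_lim) auto
    moreover have "tr (g n) 0 * g (Suc n) x = tr (g n) x" for n
      using tr_pos[of 0 n] by (simp add: g_Suc)
    ultimately have "tr h x = tr h 0 * h x" using LIMSEQ_unique[OF tr_lim[OF x]] by simp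
    thus "1/2 * (W (b1 x) * h (b1 x) + W (b2 x) * h (b2 x)) = tr h 0 * h x" by (simp add: tr_def)
  qed (rule h)
qed

end

section \<open>Spectral gap of the transfer operator\<close>

lemma bounded_linear_funpow:
  fixes f :: "'a::real_normed_vector \<Rightarrow> 'a"
  assumes "bounded_linear f"
  shows "bounded_linear (f ^^ n)"
proof (induction n)
  case 0
  have "f ^^ 0 = (\<lambda>x. x)" by (simp add: fun_eq_iff)
  thus ?case by (simp only: bounded_linear_ident)
next
  case (Suc n)
  from bounded_linear_compose[OF assms this] show ?case by (simp add: o_def)
qed

text \<open>The kernel of \<open>ell\<close> is closed by continuity, is invariant by
  \<open>inv\<close>, and complements the line through \<open>u\<close> via the splitting of
  \<open>f\<close> into \<open>ell f *\<^sub>R u\<close> and the remainder.\<close>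

lemma has_spectral_gapI:
  fixes L :: "'a::banach \<Rightarrow> 'a" and ell :: "'a \<Rightarrow> real"
  assumes L: "bounded_linear L" and ell: "bounded_linear ell"
    and lam: "0 < lam" and u: "L u = lam *\<^sub>R u" "ell u = 1"
    and inv: "\<And>f. ell (L f) = lam * ell f"
    and C: "0 < C" and \<delta>: "0 < \<delta>" "\<delta> < 1"
    and decay: "\<And>n f. ell f = 0 \<Longrightarrow> norm ((L ^^ n) f) \<le> C * lam ^ n * (1 - \<delta>) ^ n * norm f"
  shows "has_spectral_gap L"
proof -
  interpret ell: bounded_linear ell by fact
  let ?G = "{f. ell f = 0}"
  have sub: "subspace ?G" by (auto simp: subspace_def ell.zero ell.add ell.scaleR)
  have "closed (ell -` {0})"
    by (intro continuous_closed_vimage closed_singleton) (simp add: ell.isCont)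
  hence closed: "closed ?G" by (simp add: vimage_def)
  have "span {u} \<inter> ?G = {0}"
    by (auto simp: span_singleton ell.zero ell.scaleR u intro!: exI[of _ 0])
  moreover have "{v + g | v g. v \<in> span {u} \<and> g \<in> ?G} = UNIV"
  proof (intro equalityI subsetI UNIV_I CollectI exI conjI)
    fix f show "f = ell f *\<^sub>R u + (f - ell f *\<^sub>R u)" by simp
    show "ell f *\<^sub>R u \<in> span {u}" by (auto simp: span_singleton)
    show "ell (f - ell f *\<^sub>R u) = 0" by (simp add: ell.diff ell.scaleR u)
  qed
  moreover have "onorm_on ?G (L ^^ n) \<le> C * lam ^ n * (1 - \<delta>) ^ n" for n
    using lam C \<delta> decay by (subst onorm_on_le_iff[OF bounded_linear_funpow[OF L] sub]) auto
  moreover have "u \<noteq> 0" using u(2) ell.zero by auto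
  moreover have "L ` ?G \<subseteq> ?G" by (auto simp: inv)
  ultimately show ?thesis
    unfolding has_spectral_gap_def
    using L lam u(1) sub closed C \<delta> by (intro conjI exI[of _ lam] exI[of _ u] exI[of _ ?G] exI[of _ C] exI[of _ \<delta>]) auto
qed

section \<open>The gap for a transfer operator with two inverse branches\<close>

context inverse_branches
begin

lemma transfer_has_spectral_gap:
  fixes L :: "lip01 \<Rightarrow> lip01"
  assumes W: "rel_lip (3/2000) W"
    and L: "\<And>f x. x \<in> {0..1} \<Longrightarrow>
      lip_app (L f) x = 1/2 * (W (b1 x) * lip_app f (b1 x) + W (b2 x) * lip_app f (b2 x))"
  shows "has_spectral_gap L"
proof -
  obtain h lam where lam: "0 < lam" and h: "rel_lip (1/100) h" "h 0 = 1"
    and eig: "\<And>x. x \<in> {0..1} \<Longrightarrow> 1/2 * (W (b1 x) * h (b1 x) + W (b2 x) * h (b2 x)) = lam * h x"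
    using eigenfunction[OF W] by blast
  define F where "F x = W x * h x" for x
  have F: "rel_lip (3/250) F"
    unfolding F_def by (rule rel_lip_mono[OF rel_lip_mult[OF W h(1)]]) simp
  have h_pos: "0 < h x" if "x \<in> {0..1}" for x using rel_lip_pos[OF h(1) that] .
  have h_ge: "100/101 \<le> h x" if "x \<in> {0..1}" for x
    using rel_lip_le[OF h(1) _ that, of 0] h(2) by simp
  have h_le: "h x \<le> 101/100" if "x \<in> {0..1}" for x
    using rel_lip_le[OF h(1) that, of 0] h(2) by simp
  define qt where "qt f x = lip_app f x / h x" for f x

  have L_avg: "lip_app (L f) x = lam * h x * avg F (qt f) x" if x: "x \<in> {0..1}" for f x
  proof -
    have p: "0 < F (b1 x)" "0 < F (b2 x)" "0 < h (b1 x)" "0 < h (b2 x)"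
      using rel_lip_pos[OF F] h_pos b1_in b2_in x by auto
    \<comment> \<open>The eigenvalue equation turns the denominator of \<open>avg\<close> into twice
      \<open>lam * h x\<close>.\<close>
    have "lam * h x = (F (b1 x) + F (b2 x)) / 2" using eig[OF x] by (simp add: F_def)
    hence "lam * h x * avg F (qt f) x
        = 1/2 * (F (b1 x) * qt f (b1 x) + F (b2 x) * qt f (b2 x))"
      using p by (simp only: avg_def) (simp add: divide_simps)
    also have "\<dots> = lip_app (L f) x" using p x by (simp add: L qt_def F_def)
    finally show ?thesis by simp
  qed
  have qt_L: "qt (L f) x = lam * avg F (qt f) x" if "x \<in> {0..1}" for f x
    using h_pos[OF that] by (simp add: qt_def[of "L f"] L_avg[OF that])
  have qt_power: "qt ((L ^^ n) f) x = lam ^ n * (avg F ^^ n) (qt f) x" if "x \<in> {0..1}" for n f x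
    using that
  proof (induction n arbitrary: x)
    case (Suc n)
    have "qt ((L ^^ Suc n) f) x = lam * avg F (qt ((L ^^ n) f)) x" using qt_L Suc.prems by simp
    also have "avg F (qt ((L ^^ n) f)) x = avg F (\<lambda>x. lam ^ n * (avg F ^^ n) (qt f) x) x"
      by (rule avg_cong) (use Suc in auto)
    also have "\<dots> = lam ^ n * (avg F ^^ Suc n) (qt f) x"
      using avg_power_cmult[of 1 F "lam ^ n" "(avg F ^^ n) (qt f)"] by simp
    finally show ?case by (simp add: mult.assoc)
  qed simp

  \<comment> \<open>Division by \<open>h\<close> costs at most 1.01 in the sup norm and 1.0201 in
    the Lipschitz constant; both are rounded up to 2.\<close>
  have qt_bound: "\<bar>qt f x\<bar> \<le> 2 * norm f" if x: "x \<in> {0..1}" for f x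
  proof -
    have "\<bar>qt f x\<bar> = \<bar>lip_app f x\<bar> / h x" using h_pos[OF x] by (simp add: qt_def)
    also have "\<dots> \<le> norm f / (100/101)"
      by (intro frac_le lip01_sup_le_norm h_ge x) auto
    also have "\<dots> \<le> 2 * norm f" by simp
    finally show ?thesis .
  qed
  have qt_lip: "(2 * norm f)-lipschitz_on {0..1} (qt f)" for f
  proof -
    have "lip_const (lip_app f) \<le> norm f"
      using sup01_nonneg[of "lip_app f"] by (simp add: norm_lip01_def)
    hence "\<bar>lip_app f x - lip_app f y\<bar> \<le> norm f * \<bar>x - y\<bar>" if "x \<in> {0..1}" "y \<in> {0..1}" for x y
      using lip_const_upper[OF lip_app_is_lip that, of f]
      by (meson abs_ge_zero mult_right_mono order_trans)
    hence f: "(norm f)-lipschitz_on {0..1} (lip_app f)"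
      by (intro lipschitz_onI) (auto simp: dist_real_def)
    have "((norm f + norm f * (1/100)) / (100/101))-lipschitz_on {0..1} (qt f)"
      unfolding qt_def
      by (rule lipschitz_on_divide_rel_lip[OF f lip01_sup_le_norm h(1) _ h_ge]) auto
    thus ?thesis by (rule lipschitz_on_le) simp
  qed
  \<comment> \<open>The way back from quotients to the norm: multiplication by \<open>h\<close>
    costs 1.01 + 1.01 + 0.0101, rounded up to 4. The factor \<open>c\<close> will be
    \<open>lam\<close> or \<open>lam ^ n\<close>.\<close>
  have norm_bound: "norm f \<le> 4 * c * s"
    if f: "\<And>x. x \<in> {0..1} \<Longrightarrow> qt f x = c * v x" and c: "0 \<le> c"
      and v: "\<And>x. x \<in> {0..1} \<Longrightarrow> \<bar>v x\<bar> \<le> s" and vl: "s-lipschitz_on {0..1} v" for f c v s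
  proof -
    have fx: "lip_app f x = c * (h x * v x)" if "x \<in> {0..1}" for x
      using f[OF that] h_pos[OF that] by (simp add: qt_def field_simps)
    have s: "0 \<le> s" using lipschitz_on_nonneg[OF vl] .
    have "norm f \<le> c * (101/100 * s) + c * (101/100 * s + 101/10000 * s)"
    proof (rule lip01_norm_le)
      fix x :: real assume x: "x \<in> {0..1}"
      have "c * (h x * \<bar>v x\<bar>) \<le> c * (101/100 * s)"
        using h_le[OF x] h_pos[OF x] v[OF x] s c by (intro mult_left_mono mult_mono) auto
      thus "\<bar>lip_app f x\<bar> \<le> c * (101/100 * s)"
        using fx[OF x] c h_pos[OF x] by (simp add: abs_mult)
      fix y :: real assume y: "y \<in> {0..1}"
      have "\<bar>h x * v x - h y * v y\<bar> = \<bar>h x * (v x - v y) + (h x - h y) * v y\<bar>"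
        by (simp add: algebra_simps)
      also have "\<dots> \<le> h x * \<bar>v x - v y\<bar> + \<bar>h x - h y\<bar> * \<bar>v y\<bar>"
        using h_pos[OF x] by (metis abs_mult abs_of_pos abs_triangle_ineq)
      also have "\<dots> \<le> 101/100 * (s * \<bar>x - y\<bar>) + (1/100 * \<bar>x - y\<bar> * (101/100)) * s"
      proof (intro add_mono mult_mono h_le x v y)
        show "\<bar>v x - v y\<bar> \<le> s * \<bar>x - y\<bar>"
          using lipschitz_onD[OF vl x y] by (simp add: dist_real_def)
        show "\<bar>h x - h y\<bar> \<le> 1/100 * \<bar>x - y\<bar> * (101/100)"
          by (rule order.trans[OF rel_lipD[OF h(1) x y]]) (intro mult_left_mono h_le y, simp)
      qed auto
      also have "\<dots> = (101/100 * s + 101/10000 * s) * \<bar>x - y\<bar>" by (simp add: algebra_simps)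
      finally have "c * \<bar>h x * v x - h y * v y\<bar> \<le> c * ((101/100 * s + 101/10000 * s) * \<bar>x - y\<bar>)"
        using c by (rule mult_left_mono)
      thus "\<bar>lip_app f x - lip_app f y\<bar> \<le> c * (101/100 * s + 101/10000 * s) * \<bar>x - y\<bar>"
        using fx x y c by (simp add: abs_mult mult.assoc flip: right_diff_distrib)
    qed
    also have "\<dots> = 20301/10000 * (c * s)" by (simp add: algebra_simps)
    also have "\<dots> \<le> 4 * (c * s)" using c s by (intro mult_right_mono) auto
    finally show ?thesis by simp
  qed

  have L_bl: "bounded_linear L"
  proof (rule bounded_linear_intro[where K = "4 * lam * 2"])
    fix f g :: lip01 and k :: real
    show "L (f + g) = L f + L g"
      by (rule lip01_eqI) (simp add: L lip_app_simps algebra_simps)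
    show "L (k *\<^sub>R f) = k *\<^sub>R L f"
      by (rule lip01_eqI) (simp add: L lip_app_simps algebra_simps)
    have "norm (L f) \<le> 4 * lam * (2 * norm f)"
    proof (rule norm_bound[OF qt_L])
      show "\<bar>avg F (qt f) x\<bar> \<le> 2 * norm f" if "x \<in> {0..1}" for x
        using avg_bound[OF F _ that, of "qt f" 0] qt_bound by simp
      show "(2 * norm f)-lipschitz_on {0..1} (avg F (qt f))"
        by (rule lipschitz_on_le[OF avg_lipschitz[OF F qt_lip]]) simp
    qed (use lam in auto)
    thus "norm (L f) \<le> norm f * (4 * lam * 2)" by (simp add: mult_ac)
  qed

  \<comment> \<open>The limits are constant functions, so evaluating at 0 loses nothing. This is an
    eigenfunctional of the dual operator.\<close>
  define ell where "ell f = lim (\<lambda>n. (avg F ^^ n) (qt f) 0)" for f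
  have ell: "(\<lambda>n. (avg F ^^ n) (qt f) 0) \<longlonglongrightarrow> ell f" for f
    using avg_power_convergent[OF F qt_lip] unfolding ell_def by (simp add: convergent_LIMSEQ_iff)
  have ell_bl: "bounded_linear ell"
  proof (rule bounded_linear_intro[where K = 2])
    fix f g :: lip01 and k :: real
    have "qt (f + g) = (\<lambda>x. qt f x + qt g x)"
      by (simp add: qt_def fun_eq_iff lip_app_simps add_divide_distrib)
    hence "(\<lambda>n. (avg F ^^ n) (qt (f + g)) 0) \<longlonglongrightarrow> ell f + ell g"
      by (simp add: avg_power_add tendsto_add ell)
    thus "ell (f + g) = ell f + ell g" using LIMSEQ_unique[OF ell] by simp
    have "qt (k *\<^sub>R f) = (\<lambda>x. k * qt f x)"
      by (simp add: qt_def fun_eq_iff lip_app_simps)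
    hence "(\<lambda>n. (avg F ^^ n) (qt (k *\<^sub>R f)) 0) \<longlonglongrightarrow> k * ell f"
      by (simp add: avg_power_cmult tendsto_mult_left ell)
    thus "ell (k *\<^sub>R f) = k *\<^sub>R ell f" using LIMSEQ_unique[OF ell] by simp
    have "\<bar>ell f\<bar> \<le> 2 * norm f"
      by (rule tendsto_upperbound[OF tendsto_rabs[OF ell]])
         (use avg_power_bound[OF F, of "qt f" 0] qt_bound in auto)
    thus "norm (ell f) \<le> norm f * 2" by simp
  qed
  have ell_L: "ell (L f) = lam * ell f" for f
  proof -
    have "(avg F ^^ n) (qt (L f)) 0 = lam * (avg F ^^ Suc n) (qt f) 0" for n
    proof -
      have "(avg F ^^ n) (qt (L f)) 0 = (avg F ^^ n) (\<lambda>x. lam * avg F (qt f) x) 0"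
        by (rule avg_power_cong) (auto simp: qt_L)
      thus ?thesis by (simp add: avg_power_cmult funpow_swap1)
    qed
    \<comment> \<open>Applying \<open>L\<close> only shifts the sequence by one index and multiplies
      it by \<open>lam\<close>.\<close>
    moreover have "(\<lambda>n. lam * (avg F ^^ Suc n) (qt f) 0) \<longlonglongrightarrow> lam * ell f"
      by (intro tendsto_mult_left LIMSEQ_Suc ell)
    ultimately show ?thesis using LIMSEQ_unique[OF ell[of "L f"]] by simp
  qed

  have "is_lip01 h" using rel_lip_lipschitz[OF h(1)] unfolding is_lip01_def by blast
  hence u: "lip_app (lip_restrict h) x = h x" if "x \<in> {0..1}" for x using that by simp
  have "qt (lip_restrict h) x = 1" if "x \<in> {0..1}" for x
    using h_pos[OF that] u[OF that] by (simp add: qt_def)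
  \<comment> \<open>Constants are fixed by averaging: deviation 0 from the centre 1.\<close>
  hence "(avg F ^^ n) (qt (lip_restrict h)) 0 = 1" for n
    using avg_power_bound[OF F, of "qt (lip_restrict h)" 1 0 0 n] by simp
  hence ell_u: "ell (lip_restrict h) = 1" by (simp add: ell_def)
  have L_u: "L (lip_restrict h) = lam *\<^sub>R lip_restrict h"
    using eig u b1_in b2_in by (intro lip01_eqI) (simp add: L lip_app_simps)

  show ?thesis
  proof (rule has_spectral_gapI[OF L_bl ell_bl lam L_u ell_u ell_L, where C = 8 and \<delta> = "1/5"])
    fix n f assume f: "ell f = 0"
    \<comment> \<open>On the kernel the limit constant is 0, so the iterates themselves decay at
      rate 4/5, giving a gap of 1/5; the constant 8 is 4 from \<open>norm_bound\<close> times 2 from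
      \<open>qt_lip\<close>.\<close>
    have "norm ((L ^^ n) f) \<le> 4 * lam ^ n * ((4/5) ^ n * (2 * norm f))"
    proof (rule norm_bound[OF qt_power])
      show "\<bar>(avg F ^^ n) (qt f) x\<bar> \<le> (4/5) ^ n * (2 * norm f)" if "x \<in> {0..1}" for x
        using avg_power_limit_diff[OF F qt_lip that ell, of n f] f by simp
      show "((4/5) ^ n * (2 * norm f))-lipschitz_on {0..1} ((avg F ^^ n) (qt f))"
        by (rule avg_power_lipschitz[OF F qt_lip])
    qed (use lam in auto)
    thus "norm ((L ^^ n) f) \<le> 8 * lam ^ n * (1 - 1/5) ^ n * norm f" by (simp add: mult_ac)
  qed auto
qed

end

text \<open>For every \<open>q > 0\<close> the left half of the map does not decrease distances
  (\<open>pm_left_expand\<close>), so its inverse does not increase them.\<close>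

lemma inverse_branches_pm:
  assumes q: "q > 0"
  shows "inverse_branches (pm_b1 q) pm_b2"
proof
  fix x y :: real assume x: "x \<in> {0..1}"
  show "pm_b1 q x \<in> {0..1}" using pm_b1(1)[OF q x] by auto
  show "pm_b2 x \<in> {0..1}" using x by (auto simp: pm_b2_def)
  assume y: "y \<in> {0..1}"
  show "\<bar>pm_b1 q x - pm_b1 q y\<bar> \<le> \<bar>x - y\<bar>"
    using pm_left_expand[OF q, of "pm_b1 q x" "pm_b1 q y"]
      pm_left_expand[OF q, of "pm_b1 q y" "pm_b1 q x"] pm_b1[OF q x] pm_b1[OF q y]
    by (cases "pm_b1 q x \<le> pm_b1 q y") auto
  show "\<bar>pm_b2 x - pm_b2 y\<bar> \<le> \<bar>x - y\<bar> / 2" by (simp add: pm_b2_def flip: diff_divide_distrib)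
qed

theorem theorem1p2:
  fixes q :: real and \<phi> :: lip01
  assumes "q > 0" and "lip_const (lip_app \<phi>) \<le> 0.0014"
  shows "has_spectral_gap (pm_transfer q \<phi>)"
proof -
  interpret inverse_branches "pm_b1 q" pm_b2 by (rule inverse_branches_pm[OF assms(1)])
  have "rel_lip (3/2000) (\<lambda>x. exp (lip_app \<phi> x))"
    using assms(2) by (intro rel_lip_exp) auto
  thus ?thesis by (rule transfer_has_spectral_gap) (simp add: lip_app_pm_transfer assms(1))
qed

end
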